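(* Let $\Omega=\{0,1\}^{\mathbb Z}$ and let $\mathbb P$ be a translation-invariant Gibbs measure on $\Omega$ with an exponentially decaying interaction (in the sense made precise in the context), with expectation $\mathbb E$. For integers $N,\ell\ge1$ and $\sigma\in\Omega$ let $$\mathcal A_N^\ell(\sigma)=\frac1N\sum_{i=1}^N\prod_{j=1}^\ell\sigma_{ji},\qquad \mathcal K(N,\ell)(\sigma)=\sum_{i=1}^{\lfloor N/\ell\rfloor}\prod_{j=1}^\ell\sigma_{ji}.$$ 1. (Gaussian concentration bound.) Let $\ell\ge1$ be an integer. There exists a constant $C>0$ such that for all $N\ge1$ and all $t>0$ $$\mathbb P\left(\left|\mathcal A_N^\ell-\mathbb E(\mathcal A_N^\ell)\right|>t\right)\le e^{-CNt^2}.$$ In particular, $\mathcal A_N^\ell$ converges $\mathbb P$-almost surely to $(\mathbb E(\sigma_0))^\ell$ as $N\to\infty$. 2. (Logarithmic upper bound for maximal monochromatic progressions.) There exists $\gamma>0$ such that for all $c>\gamma$ $$\mathcal K(N,\lfloor c\log N\rfloor)\to0\quad\text{in }\mathbb P\text{-probability as }N\to\infty.$$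
   Context: A translation-invariant probability measure $\mathbb P$ on $\Omega=\{0,1\}^{\mathbb Z}$ is called here a Gibbs measure with an exponentially decaying interaction if there is a version of the one-site conditional probabilities $$\phi_{\hat\sigma}(\alpha)=\mathbb P(\sigma_0=\alpha\mid\sigma_{\mathbb Z\setminus\{0\}}=\hat\sigma),\qquad \alpha\in\{0,1\},\ \hat\sigma\in\{0,1\}^{\mathbb Z\setminus\{0\}},$$ such that: (i) (finite energy) there is $\delta\in(0,1)$ with $\delta<\phi_{\hat\sigma}(\alpha)<1-\delta$ for all $\alpha$ and $\hat\sigma$; (ii) there is $\rho>0$ such that for every $n$, $\|\phi_{\hat\sigma}-\phi_{\hat\eta}\|_\infty\le e^{-n\rho}$ whenever $\hat\sigma$ and $\hat\eta$ agree on $[-n,n]\cap(\mathbb Z\setminus\{0\})$. $\mathcal K(N,\ell)$ counts the arithmetic progressions $i,2i,\dots,\ell i$ contained in $[1,N]$ along which $\sigma$ equals $1$. The quantity $\mathcal K(N,\lfloor c\log N\rfloor)$ is considered for $N$ large enough that $\lfloor c\log N\rfloor\ge1$.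
   Formalization: The concentration bound is stated with right-hand side 2·exp(−CNt²) instead of exp(−CNt²); the printed bound without the factor 2 fails for N = 1 and small t, where the left side equals 1. *)

theory Defs
  imports "HOL-Probability.Probability"
begin

text \<open>
  The alphabet \<open>{0,1}\<close> is \<^typ>\<open>bool\<close>, with \<open>True\<close> for \<open>1\<close>.  A configuration \<open>\<sigma>\<close> on the
  punctured lattice is a function on \<open>- {0}\<close>, extensional (\<^term>\<open>undefined\<close> at \<open>0\<close>) as usual
  for \<^const>\<open>PiM\<close>.
\<close>

definition configs :: "(int \<Rightarrow> bool) measure" where
  "configs = (\<Pi>\<^sub>M i\<in>UNIV. count_space UNIV)"

definition punctured_configs :: "(int \<Rightarrow> bool) measure" where
  "punctured_configs = (\<Pi>\<^sub>M i\<in>- {0}. count_space UNIV)"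

definition off_origin :: "(int \<Rightarrow> bool) \<Rightarrow> int \<Rightarrow> bool" where
  "off_origin \<sigma> = restrict \<sigma> (- {0})"

definition translation_invariant :: "(int \<Rightarrow> bool) measure \<Rightarrow> bool" where
  "translation_invariant P \<longleftrightarrow> (\<forall>k. distr P configs (\<lambda>\<sigma> i. \<sigma> (i + k)) = P)"

text \<open>
  \<open>\<phi> \<eta> \<alpha>\<close> is the probability of the symbol \<open>\<alpha>\<close> at the origin given \<open>\<eta>\<close> elsewhere.
\<close>

definition cond_prob_version ::
    "(int \<Rightarrow> bool) measure \<Rightarrow> ((int \<Rightarrow> bool) \<Rightarrow> bool \<Rightarrow> real) \<Rightarrow> bool" where
  "cond_prob_version P \<phi> \<longleftrightarrow>
     (\<forall>\<alpha>. (\<lambda>\<eta>. \<phi> \<eta> \<alpha>) \<in> borel_measurable punctured_configs \<and>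
       (AE \<sigma> in P. \<phi> (off_origin \<sigma>) \<alpha> =
          real_cond_exp P (vimage_algebra (space P) off_origin punctured_configs)
            (indicator {\<sigma> \<in> space P. \<sigma> 0 = \<alpha>}) \<sigma>))"

definition finite_energy :: "((int \<Rightarrow> bool) \<Rightarrow> bool \<Rightarrow> real) \<Rightarrow> bool" where
  "finite_energy \<phi> \<longleftrightarrow>
     (\<exists>\<delta>. 0 < \<delta> \<and> \<delta> < 1 \<and>
       (\<forall>\<eta>\<in>space punctured_configs. \<forall>\<alpha>. \<delta> < \<phi> \<eta> \<alpha> \<and> \<phi> \<eta> \<alpha> < 1 - \<delta>))"

definition exp_decaying :: "((int \<Rightarrow> bool) \<Rightarrow> bool \<Rightarrow> real) \<Rightarrow> bool" where
  "exp_decaying \<phi> \<longleftrightarrow>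
     (\<exists>\<rho>>0. \<forall>n::nat. \<forall>\<eta>\<in>space punctured_configs. \<forall>\<eta>'\<in>space punctured_configs.
       (\<forall>i\<in>{- int n..int n} \<inter> - {0}. \<eta> i = \<eta>' i) \<longrightarrow>
       (MAX \<alpha>. \<bar>\<phi> \<eta> \<alpha> - \<phi> \<eta>' \<alpha>\<bar>) \<le> exp (- (real n * \<rho>)))"

definition exp_decaying_gibbs :: "(int \<Rightarrow> bool) measure \<Rightarrow> bool" where
  "exp_decaying_gibbs P \<longleftrightarrow>
     prob_space P \<and> sets P = sets configs \<and> translation_invariant P \<and>
     (\<exists>\<phi>. cond_prob_version P \<phi> \<and> finite_energy \<phi> \<and> exp_decaying \<phi>)"

definition nonconv_avg :: "nat \<Rightarrow> nat \<Rightarrow> (int \<Rightarrow> bool) \<Rightarrow> real" where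
  "nonconv_avg N l \<sigma> =
     1 / real N * (\<Sum>i=1..N. \<Prod>j=1..l. of_bool (\<sigma> (int j * int i)))"

definition num_progressions :: "nat \<Rightarrow> nat \<Rightarrow> (int \<Rightarrow> bool) \<Rightarrow> real" where
  "num_progressions N l \<sigma> =
     (\<Sum>i=1..N div l. \<Prod>j=1..l. of_bool (\<sigma> (int j * int i)))"

definition tendsto_zero_in_prob ::
    "'a measure \<Rightarrow> (nat \<Rightarrow> 'a \<Rightarrow> real) \<Rightarrow> bool" where
  "tendsto_zero_in_prob M X \<longleftrightarrow>
     (\<forall>\<epsilon>>0. (\<lambda>n. measure M {x \<in> space M. \<bar>X n x\<bar> > \<epsilon>}) \<longlonglongrightarrow> 0)"

end

theory Submission
  imports Defs "HOL-Library.Discrete_Functions"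
begin

text \<open>
  Conditional expectations given a cylinder only involve the one-site ratios
  \<open>P(\<sigma>\<^sub>i | \<sigma> on S)\<close>, which are averages of \<open>\<phi>\<close> and hence vary by at most \<open>2 r ^ n\<close> once \<open>S\<close>
  contains the punctured \<open>n\<close>-neighbourhood of \<open>i\<close>.  Flipping the sites of an interval one by one
  shows that, up to a factor \<open>exp (O(r ^ s))\<close>, its conditional law ignores everything beyond a collar
  of width \<open>s\<close>; for \<open>s = 0\<close> this is a bounded density, so passing through a collar contracts
  oscillations and the law mixes at a summable rate.  For a function that is Lipschitz in each
  coordinate, revealing the coordinates from left to right then yields martingale differences
  bounded by a multiple of the Lipschitz constant, and Hoeffding's lemma applies at each step.
  Almost sure convergence is Borel-Cantelli together with
  \<open>E \<Prod>\<^sub>j \<sigma>\<^sub>j\<^sub>i \<rightarrow> (E \<sigma>\<^sub>0) ^ l\<close>, again by mixing.  For long progressions, finite energy gives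
  probability at most \<open>(1 - \<delta>) ^ l\<close> to each of the at most \<open>N\<close> progressions.
\<close>

subsection \<open>Cylinders and local functions\<close>

text \<open>The function \<open>\<phi>\<close> depends on all sites and is tied to \<open>P\<close>
  only almost everywhere. Conditioning on infinitely many sites is therefore confined to the
  one-site estimate; elsewhere all conditioning is on finite cylinders, where it is a quotient of
  positive numbers. Two boundary conditions may then fix different sets of sites, and comparison
  with \<open>P\<close> itself is the case of an empty boundary.

  Contraction through collars of a fixed width \<open>s\<close> stalls at an error of order
  \<open>r ^ s\<close>. Letting both the number and the width of the collars grow like the square
  root of the depth gives a stretched exponential rate, which is weakened to an inverse square:
  summability is what the concentration bound uses.

  Mixing alone controls a martingale difference only through the total oscillation of the function,
  which may grow with the number of sites. Splitting a Lipschitz function coordinate by coordinate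
  lets the site at distance \<open>n\<close> contribute only its Lipschitz constant times the mixing
  rate at \<open>n\<close>.\<close>

definition cylinder :: "int set \<Rightarrow> (int \<Rightarrow> bool) \<Rightarrow> (int \<Rightarrow> bool) set" where
  "cylinder S \<eta> = {\<sigma>. \<forall>i\<in>S. \<sigma> i = \<eta> i}"

definition depends_on :: "int set \<Rightarrow> ((int \<Rightarrow> bool) \<Rightarrow> 'a) \<Rightarrow> bool" where
  "depends_on W h \<longleftrightarrow> (\<forall>\<sigma> \<tau>. (\<forall>i\<in>W. \<sigma> i = \<tau> i) \<longrightarrow> h \<sigma> = h \<tau>)"

text \<open>Finite support makes boundedness and integrability automatic and turns conditional
  integrals into finite sums over patterns.\<close>

definition local_fun :: "((int \<Rightarrow> bool) \<Rightarrow> 'a) \<Rightarrow> bool" where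
  "local_fun h \<longleftrightarrow> (\<exists>W. finite W \<and> depends_on W h)"

lemma cylinder_empty [simp]: "cylinder {} \<eta> = UNIV"
  by (simp add: cylinder_def)

lemma cylinder_cong: "(\<And>i. i \<in> S \<Longrightarrow> \<eta> i = \<zeta> i) \<Longrightarrow> cylinder S \<eta> = cylinder S \<zeta>"
  by (auto simp: cylinder_def)

lemma depends_onD: "depends_on W h \<Longrightarrow> (\<And>i. i \<in> W \<Longrightarrow> \<sigma> i = \<tau> i) \<Longrightarrow> h \<sigma> = h \<tau>"
  by (simp add: depends_on_def)

lemma depends_on_mono: "depends_on V h \<Longrightarrow> V \<subseteq> W \<Longrightarrow> depends_on W h"
  unfolding depends_on_def by blast

lemma depends_on_comp: "depends_on W h \<Longrightarrow> depends_on W (\<lambda>\<sigma>. g (h \<sigma>))"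
  unfolding depends_on_def by metis

lemma depends_on_comp2:
  "depends_on W h \<Longrightarrow> depends_on W k \<Longrightarrow> depends_on W (\<lambda>\<sigma>. g (h \<sigma>) (k \<sigma>))"
  unfolding depends_on_def by metis

lemma depends_on_const [simp]: "depends_on W (\<lambda>_. c)"
  by (simp add: depends_on_def)

lemma depends_on_cylinder: "depends_on S (indicator (cylinder S \<eta>))"
  by (auto simp: depends_on_def cylinder_def indicator_def)

lemma local_funI: "finite W \<Longrightarrow> depends_on W h \<Longrightarrow> local_fun h"
  by (auto simp: local_fun_def)

lemma local_fun_const [simp]: "local_fun (\<lambda>_. c)"
  by (rule local_funI[of "{}"]) auto

lemma local_fun_comp: "local_fun h \<Longrightarrow> local_fun (\<lambda>\<sigma>. g (h \<sigma>))"
  unfolding local_fun_def using depends_on_comp by blast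

lemma local_fun_comp2:
  assumes "local_fun h" "local_fun k"
  shows "local_fun (\<lambda>\<sigma>. g (h \<sigma>) (k \<sigma>))"
proof -
  obtain V W where "finite V" "depends_on V h" "finite W" "depends_on W k"
    using assms by (auto simp: local_fun_def)
  hence "depends_on (V \<union> W) (\<lambda>\<sigma>. g (h \<sigma>) (k \<sigma>))"
    using depends_on_comp2[OF depends_on_mono[of V h "V \<union> W"] depends_on_mono[of W k "V \<union> W"]]
    by simp
  thus ?thesis using \<open>finite V\<close> \<open>finite W\<close> by (auto intro: local_funI[of "V \<union> W"])
qed

lemma local_fun_sum:
  assumes "\<And>i. i \<in> I \<Longrightarrow> local_fun (f i)"
  shows "local_fun (\<lambda>\<sigma>. \<Sum>i\<in>I. f i \<sigma> :: real)"
  using assms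
  by (induction I rule: infinite_finite_induct) (auto intro: local_fun_comp2[where g = "(+)"])

lemma depends_on_override:
  assumes "depends_on W h"
  shows "depends_on (W - A) (\<lambda>\<sigma>. h (override_on \<sigma> \<zeta> A))"
  using assms by (auto simp: depends_on_def override_on_def)

lemma local_fun_override:
  assumes "local_fun h"
  shows "local_fun (\<lambda>\<sigma>. h (override_on \<sigma> \<zeta> A))"
  using assms depends_on_override unfolding local_fun_def by (metis finite_Diff)

text \<open>Only the pattern \<open>restrict \<sigma> A\<close> can contribute to the sum;
  extensionality of the patterns makes it unique.\<close>

lemma cylinder_split:
  assumes "finite A" "A \<inter> B = {}"
  shows "indicator (cylinder B \<eta>) \<sigma> =
    (\<Sum>a\<in>PiE A (\<lambda>_. UNIV). indicator (cylinder (A \<union> B) (override_on \<eta> a A)) \<sigma> :: real)"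
proof -
  have "(\<Sum>a\<in>PiE A (\<lambda>_. UNIV). indicator (cylinder (A \<union> B) (override_on \<eta> a A)) \<sigma> :: real) =
    (\<Sum>a\<in>PiE A (\<lambda>_. UNIV). if a = restrict \<sigma> A then indicator (cylinder B \<eta>) \<sigma> else 0)"
  proof (rule sum.cong)
    fix a :: "int \<Rightarrow> bool" assume a: "a \<in> PiE A (\<lambda>_. UNIV)"
    have "\<sigma> \<in> cylinder (A \<union> B) (override_on \<eta> a A) \<longleftrightarrow> a = restrict \<sigma> A \<and> \<sigma> \<in> cylinder B \<eta>"
    proof
      assume *: "\<sigma> \<in> cylinder (A \<union> B) (override_on \<eta> a A)"
      have "a = restrict \<sigma> A"
      proof
        fix i show "a i = restrict \<sigma> A i"
          using * a by (cases "i \<in> A") (auto simp: cylinder_def)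
      qed
      moreover have "\<sigma> \<in> cylinder B \<eta>"
        using * assms(2) by (auto simp: cylinder_def override_on_def)
      ultimately show "a = restrict \<sigma> A \<and> \<sigma> \<in> cylinder B \<eta>" by blast
    next
      assume "a = restrict \<sigma> A \<and> \<sigma> \<in> cylinder B \<eta>"
      thus "\<sigma> \<in> cylinder (A \<union> B) (override_on \<eta> a A)"
        using assms(2) by (auto simp: cylinder_def override_on_def)
    qed
    thus "indicator (cylinder (A \<union> B) (override_on \<eta> a A)) \<sigma> =
      (if a = restrict \<sigma> A then indicator (cylinder B \<eta>) \<sigma> else 0 :: real)"
      by (auto simp: indicator_def)
  qed simp
  also have "\<dots> = indicator (cylinder B \<eta>) \<sigma>"
    using assms(1) by (subst sum.delta) (auto simp: finite_PiE)
  finally show ?thesis by simp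
qed

section \<open>Elementary conditioning on finite cylinders\<close>

locale configuration_law = prob_space P for P :: "(int \<Rightarrow> bool) measure" +
  assumes sets_P: "sets P = sets configs"
begin

lemma space_P [simp]: "space P = UNIV"
  using sets_eq_imp_space_eq[OF sets_P] by (auto simp: configs_def space_PiM)

lemma coordinate_measurable [measurable]: "(\<lambda>\<sigma>. \<sigma> i) \<in> measurable P (count_space UNIV)"
proof -
  have "(\<lambda>\<sigma>. \<sigma> i) \<in> measurable configs (count_space UNIV)"
    unfolding configs_def by measurable
  thus ?thesis using measurable_cong_sets[OF sets_P refl] by blast
qed

lemma cylinder_sets [measurable]: "finite S \<Longrightarrow> cylinder S \<eta> \<in> sets P"
proof -
  assume "finite S"
  hence "{\<sigma> \<in> space P. \<forall>i\<in>S. \<sigma> i = \<eta> i} \<in> sets P"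
    by measurable
  thus ?thesis by (simp add: cylinder_def)
qed

lemma local_fun_measurable:
  fixes h :: "(int \<Rightarrow> bool) \<Rightarrow> real"
  assumes "local_fun h"
  shows "h \<in> borel_measurable P"
proof -
  obtain W where W: "finite W" "depends_on W h" using assms by (auto simp: local_fun_def)
  have "h \<sigma> = (\<Sum>a\<in>PiE W (\<lambda>_. UNIV). h a * indicator (cylinder W a) \<sigma>)" for \<sigma>
  proof -
    have "(\<Sum>a\<in>PiE W (\<lambda>_. UNIV). h a * indicator (cylinder W a) \<sigma>) =
      (\<Sum>a\<in>PiE W (\<lambda>_. UNIV). if a = restrict \<sigma> W then h \<sigma> else 0)"
    proof (rule sum.cong)
      fix a :: "int \<Rightarrow> bool" assume a: "a \<in> PiE W (\<lambda>_. UNIV)"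
      have eq: "\<sigma> \<in> cylinder W a \<longleftrightarrow> a = restrict \<sigma> W"
      proof
        assume *: "\<sigma> \<in> cylinder W a"
        show "a = restrict \<sigma> W"
        proof
          fix i show "a i = restrict \<sigma> W i"
            using * a by (cases "i \<in> W") (auto simp: cylinder_def)
        qed
      qed (auto simp: cylinder_def)
      have "h (restrict \<sigma> W) = h \<sigma>" by (rule depends_onD[OF W(2)]) auto
      with eq show "h a * indicator (cylinder W a) \<sigma> = (if a = restrict \<sigma> W then h \<sigma> else 0)"
        by (auto simp: indicator_def)
    qed simp
    also have "\<dots> = h \<sigma>"
      using W(1) by (subst sum.delta) (auto simp: finite_PiE)
    finally show ?thesis by simp
  qed
  hence "h = (\<lambda>\<sigma>. \<Sum>a\<in>PiE W (\<lambda>_. UNIV). h a * indicator (cylinder W a) \<sigma>)" by (rule ext)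
  moreover have "\<dots> \<in> borel_measurable P" using W(1) by measurable
  ultimately show ?thesis by simp
qed

lemma local_fun_bounded:
  fixes h :: "(int \<Rightarrow> bool) \<Rightarrow> real"
  assumes "local_fun h"
  obtains c where "\<And>\<sigma>. \<bar>h \<sigma>\<bar> \<le> c"
proof -
  obtain W where W: "finite W" "depends_on W h" using assms by (auto simp: local_fun_def)
  have "\<bar>h \<sigma>\<bar> \<le> (\<Sum>a\<in>PiE W (\<lambda>_. UNIV). \<bar>h a\<bar>)" for \<sigma>
  proof -
    have "h (restrict \<sigma> W) = h \<sigma>" by (rule depends_onD[OF W(2)]) auto
    moreover have "\<bar>h (restrict \<sigma> W)\<bar> \<le> (\<Sum>a\<in>PiE W (\<lambda>_. UNIV). \<bar>h a\<bar>)"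
      by (rule member_le_sum) (use W(1) in \<open>auto simp: finite_PiE\<close>)
    ultimately show ?thesis by simp
  qed
  thus ?thesis using that by blast
qed

lemma local_fun_integrable:
  fixes h :: "(int \<Rightarrow> bool) \<Rightarrow> real"
  assumes "local_fun h"
  shows "integrable P h"
proof -
  obtain c where "\<And>\<sigma>. \<bar>h \<sigma>\<bar> \<le> c" using local_fun_bounded[OF assms] by blast
  thus ?thesis
    by (intro integrable_const_bound[of h c] local_fun_measurable assms) auto
qed

lemma local_fun_integrable_cylinder:
  fixes h :: "(int \<Rightarrow> bool) \<Rightarrow> real"
  assumes "local_fun h" "finite B"
  shows "integrable P (\<lambda>\<sigma>. indicator (cylinder B \<eta>) \<sigma> * h \<sigma>)"
  by (intro local_fun_integrable local_fun_comp2[OF _ assms(1), where g = "(*)"]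
      local_funI[OF assms(2) depends_on_cylinder])

abbreviation cyl_prob :: "int set \<Rightarrow> (int \<Rightarrow> bool) \<Rightarrow> real" where
  "cyl_prob S \<eta> \<equiv> measure P (cylinder S \<eta>)"

text \<open>Conditional expectation given a single event, as a quotient, so that no version has to
  be chosen.\<close>

definition cyl_exp :: "int set \<Rightarrow> (int \<Rightarrow> bool) \<Rightarrow> ((int \<Rightarrow> bool) \<Rightarrow> real) \<Rightarrow> real" where
  "cyl_exp B \<eta> h = (\<integral>\<sigma>. indicator (cylinder B \<eta>) \<sigma> * h \<sigma> \<partial>P) / cyl_prob B \<eta>"

lemma cyl_exp_cong:
  assumes "\<And>i. i \<in> B \<Longrightarrow> \<eta> i = \<zeta> i" "\<And>\<sigma>. \<sigma> \<in> cylinder B \<eta> \<Longrightarrow> h \<sigma> = k \<sigma>"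
  shows "cyl_exp B \<eta> h = cyl_exp B \<zeta> k"
proof -
  have "cylinder B \<eta> = cylinder B \<zeta>" using assms(1) by (rule cylinder_cong)
  moreover have "indicator (cylinder B \<eta>) \<sigma> * h \<sigma> = indicator (cylinder B \<eta>) \<sigma> * k \<sigma>" for \<sigma>
    using assms(2)[of \<sigma>] by (auto simp: indicator_def)
  ultimately show ?thesis unfolding cyl_exp_def by presburger
qed

lemma cyl_exp_empty: "cyl_exp {} \<eta> h = (\<integral>\<sigma>. h \<sigma> \<partial>P)"
  using prob_space by (simp add: cyl_exp_def)

lemma integral_cylinder_split:
  fixes h :: "(int \<Rightarrow> bool) \<Rightarrow> real"
  assumes "local_fun h" "finite A" "finite B" "A \<inter> B = {}"
  shows "(\<integral>\<sigma>. indicator (cylinder B \<eta>) \<sigma> * h \<sigma> \<partial>P) =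
    (\<Sum>a\<in>PiE A (\<lambda>_. UNIV). \<integral>\<sigma>. indicator (cylinder (A \<union> B) (override_on \<eta> a A)) \<sigma> * h \<sigma> \<partial>P)"
proof -
  have "(\<integral>\<sigma>. indicator (cylinder B \<eta>) \<sigma> * h \<sigma> \<partial>P) =
    (\<integral>\<sigma>. (\<Sum>a\<in>PiE A (\<lambda>_. UNIV). indicator (cylinder (A \<union> B) (override_on \<eta> a A)) \<sigma> * h \<sigma>) \<partial>P)"
    by (simp add: cylinder_split[OF assms(2,4)] sum_distrib_right)
  also have "\<dots> = (\<Sum>a\<in>PiE A (\<lambda>_. UNIV).
      \<integral>\<sigma>. indicator (cylinder (A \<union> B) (override_on \<eta> a A)) \<sigma> * h \<sigma> \<partial>P)"
    using assms by (intro Bochner_Integration.integral_sum local_fun_integrable_cylinder) auto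
  finally show ?thesis .
qed

lemma cyl_prob_split:
  assumes "finite A" "finite B" "A \<inter> B = {}"
  shows "cyl_prob B \<eta> = (\<Sum>a\<in>PiE A (\<lambda>_. UNIV). cyl_prob (A \<union> B) (override_on \<eta> a A))"
  using integral_cylinder_split[of "\<lambda>_. 1" A B \<eta>] assms by simp

lemma integral_cylinder_determined:
  fixes h :: "(int \<Rightarrow> bool) \<Rightarrow> real"
  assumes "depends_on S h" "finite S"
  shows "(\<integral>\<sigma>. indicator (cylinder S \<eta>) \<sigma> * h \<sigma> \<partial>P) = h \<eta> * cyl_prob S \<eta>"
proof -
  have "indicator (cylinder S \<eta>) \<sigma> * h \<sigma> = h \<eta> * indicator (cylinder S \<eta>) \<sigma>" for \<sigma>
    using depends_onD[OF assms(1), of \<sigma> \<eta>] by (auto simp: indicator_def cylinder_def)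
  hence "(\<integral>\<sigma>. indicator (cylinder S \<eta>) \<sigma> * h \<sigma> \<partial>P) = (\<integral>\<sigma>. h \<eta> * indicator (cylinder S \<eta>) \<sigma> \<partial>P)"
    by presburger
  thus ?thesis by simp
qed

lemma cyl_prob_flip:
  assumes "finite S" "i \<notin> S"
  shows "cyl_prob (insert i S) \<eta> + cyl_prob (insert i S) (\<eta>(i := \<not> \<eta> i)) = cyl_prob S \<eta>"
proof -
  have "cylinder S \<eta> = cylinder (insert i S) \<eta> \<union> cylinder (insert i S) (\<eta>(i := \<not> \<eta> i))"
    using assms(2) by (auto simp: cylinder_def)
  moreover have "cylinder (insert i S) \<eta> \<inter> cylinder (insert i S) (\<eta>(i := \<not> \<eta> i)) = {}"
    using assms(2) by (auto simp: cylinder_def)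
  ultimately show ?thesis
    using assms(1) by (simp add: finite_measure_Union)
qed

lemma cyl_exp_mono:
  assumes "local_fun h" "local_fun k" "finite B" "\<And>\<sigma>. h \<sigma> \<le> k \<sigma>"
  shows "cyl_exp B \<eta> h \<le> cyl_exp B \<eta> k"
  unfolding cyl_exp_def
  by (intro divide_right_mono integral_mono local_fun_integrable_cylinder mult_left_mono assms) auto

lemma cyl_exp_add:
  assumes "local_fun h" "local_fun k" "finite B"
  shows "cyl_exp B \<eta> (\<lambda>\<sigma>. h \<sigma> + k \<sigma>) = cyl_exp B \<eta> h + cyl_exp B \<eta> k"
  using local_fun_integrable_cylinder[OF assms(1,3)] local_fun_integrable_cylinder[OF assms(2,3)]
  by (simp add: cyl_exp_def distrib_left add_divide_distrib)

lemma cyl_exp_cmult: "cyl_exp B \<eta> (\<lambda>\<sigma>. c * h \<sigma>) = c * cyl_exp B \<eta> h"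
proof -
  have "indicator (cylinder B \<eta>) \<sigma> * (c * h \<sigma>) = c * (indicator (cylinder B \<eta>) \<sigma> * h \<sigma>)" for \<sigma>
    by simp
  thus ?thesis by (simp only: cyl_exp_def integral_mult_right_zero times_divide_eq_right)
qed

end

subsection \<open>Dependence on the boundary condition\<close>

text \<open>What mixing and concentration use of the Gibbs property. In \<open>decay\<close> the
  factor 2 arises because both quotients lie within \<open>r ^ n\<close> of one common value of
  \<open>\<phi>\<close>; \<open>S\<close> and \<open>S'\<close> are unrelated outside the
  window.\<close>

locale quasi_local_law = configuration_law +
  fixes \<delta> r :: real
  assumes delta_pos: "0 < \<delta>" and r_pos: "0 < r" and r_less: "r < 1"
    and energy: "finite S \<Longrightarrow> i \<notin> S \<Longrightarrow> \<delta> * cyl_prob S \<eta> \<le> cyl_prob (insert i S) \<eta>"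
    and decay: "finite S \<Longrightarrow> finite S' \<Longrightarrow> i \<notin> S \<Longrightarrow> i \<notin> S' \<Longrightarrow>
      {i - int n..i + int n} - {i} \<subseteq> S \<inter> S' \<Longrightarrow>
      (\<And>j. j \<in> {i - int n..i + int n} \<Longrightarrow> \<eta> j = \<zeta> j) \<Longrightarrow>
      \<bar>cyl_prob (insert i S) \<eta> / cyl_prob S \<eta> - cyl_prob (insert i S') \<zeta> / cyl_prob S' \<zeta>\<bar> \<le> 2 * r ^ n"
begin

lemma cyl_prob_pos: "finite S \<Longrightarrow> 0 < cyl_prob S \<eta>"
proof (induction S rule: finite_induct)
  case empty
  then show ?case using prob_space by simp
next
  case (insert i S)
  have "0 < \<delta> * cyl_prob S \<eta>" using delta_pos insert by simp
  also have "\<dots> \<le> cyl_prob (insert i S) \<eta>" using energy insert by simp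
  finally show ?case .
qed

lemma cyl_exp_const: "finite B \<Longrightarrow> cyl_exp B \<eta> (\<lambda>_. c) = c"
  using cyl_prob_pos[of B \<eta>] by (simp add: cyl_exp_def)

lemma cyl_exp_affine:
  assumes "local_fun h" "finite B"
  shows "cyl_exp B \<eta> (\<lambda>\<sigma>. a * h \<sigma> + b) = a * cyl_exp B \<eta> h + b"
  using cyl_exp_add[OF local_fun_comp[OF assms(1)] local_fun_const assms(2), of \<eta> "\<lambda>x. a * x" b]
  by (simp add: cyl_exp_cmult cyl_exp_const assms)

lemma cyl_exp_bounds:
  assumes "local_fun h" "finite B" "\<And>\<sigma>. a \<le> h \<sigma>" "\<And>\<sigma>. h \<sigma> \<le> b"
  shows "a \<le> cyl_exp B \<eta> h" "cyl_exp B \<eta> h \<le> b"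
  using cyl_exp_mono[OF local_fun_const assms(1,2), of a \<eta>]
    cyl_exp_mono[OF assms(1) local_fun_const assms(2), of b \<eta>] assms
  by (simp_all add: cyl_exp_const)

text \<open>The inner conditional expectation is constant on every cylinder that fixes
  \<open>A \<union> B\<close>, and there it has the same integral as \<open>h\<close>; summing over
  the patterns on \<open>A\<close> gives the tower property.\<close>

lemma cyl_exp_tower:
  assumes "local_fun h" "finite A" "finite B" "A \<inter> B = {}"
  shows "cyl_exp B \<eta> h = cyl_exp B \<eta> (\<lambda>\<sigma>. cyl_exp (A \<union> B) (override_on \<eta> \<sigma> A) h)"
    and "depends_on A (\<lambda>\<sigma>. cyl_exp (A \<union> B) (override_on \<eta> \<sigma> A) h)"
proof -
  define H where "H = (\<lambda>\<sigma>. cyl_exp (A \<union> B) (override_on \<eta> \<sigma> A) h)"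
  show dep: "depends_on A (\<lambda>\<sigma>. cyl_exp (A \<union> B) (override_on \<eta> \<sigma> A) h)"
    unfolding depends_on_def by (auto intro!: cyl_exp_cong simp: override_on_def)
  have "(\<integral>\<sigma>. indicator (cylinder (A \<union> B) (override_on \<eta> a A)) \<sigma> * h \<sigma> \<partial>P) =
      (\<integral>\<sigma>. indicator (cylinder (A \<union> B) (override_on \<eta> a A)) \<sigma> * H \<sigma> \<partial>P)" for a
  proof -
    let ?\<xi> = "override_on \<eta> a A"
    have "(\<integral>\<sigma>. indicator (cylinder (A \<union> B) ?\<xi>) \<sigma> * H \<sigma> \<partial>P) = H ?\<xi> * cyl_prob (A \<union> B) ?\<xi>"
      using dep assms by (intro integral_cylinder_determined) (auto simp: H_def intro: depends_on_mono)
    also have "H ?\<xi> = cyl_exp (A \<union> B) ?\<xi> h"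
      unfolding H_def by (rule cyl_exp_cong) (auto simp: override_on_def)
    also have "\<dots> * cyl_prob (A \<union> B) ?\<xi> = (\<integral>\<sigma>. indicator (cylinder (A \<union> B) ?\<xi>) \<sigma> * h \<sigma> \<partial>P)"
      using cyl_prob_pos[of "A \<union> B" ?\<xi>] assms by (simp add: cyl_exp_def)
    finally show ?thesis by simp
  qed
  moreover have "local_fun H" unfolding H_def using dep assms(2) by (rule local_funI[rotated])
  ultimately have "(\<integral>\<sigma>. indicator (cylinder B \<eta>) \<sigma> * h \<sigma> \<partial>P) = (\<integral>\<sigma>. indicator (cylinder B \<eta>) \<sigma> * H \<sigma> \<partial>P)"
    using integral_cylinder_split[OF assms] integral_cylinder_split[OF _ assms(2-4), of H] by simp
  thus "cyl_exp B \<eta> h = cyl_exp B \<eta> (\<lambda>\<sigma>. cyl_exp (A \<union> B) (override_on \<eta> \<sigma> A) h)"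
    by (simp add: cyl_exp_def H_def)
qed

text \<open>In this cross ratio the probabilities of the remaining sites cancel, and only one-site
  conditional probabilities are left. The product form lets the estimate chain over several
  sites.\<close>

lemma cyl_prob_flip_ratio:
  assumes fin: "finite T" "finite T'" and win: "{i - int n..i + int n} \<subseteq> T \<inter> T'"
    and agree: "\<And>j. j \<in> {i - int n..i + int n} \<Longrightarrow> \<alpha> j = \<beta> j"
  shows "cyl_prob T \<alpha> * cyl_prob T' (\<beta>(i := b)) \<le>
    exp (4 / \<delta> * r ^ n) * (cyl_prob T (\<alpha>(i := b)) * cyl_prob T' \<beta>)"
proof -
  have same: "\<alpha> i = \<beta> i" using agree[of i] by simp
  have one: "1 \<le> exp (4 / \<delta> * r ^ n)" using delta_pos r_pos by simp
  show ?thesis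
  proof (cases "b = \<alpha> i")
    case True
    hence "\<alpha>(i := b) = \<alpha>" "\<beta>(i := b) = \<beta>" 
      using same by (auto simp: fun_eq_iff)
    moreover have "0 \<le> cyl_prob T \<alpha> * cyl_prob T' \<beta>" by simp
    ultimately show ?thesis using one mult_right_mono[OF one] by simp
  next
    case False
    hence b: "b = (\<not> \<alpha> i)" "b = (\<not> \<beta> i)" using same by auto
    define S S' where "S = T - {i}" and "S' = T' - {i}"
    have T: "T = insert i S" "T' = insert i S'" "i \<notin> S" "i \<notin> S'" "finite S" "finite S'"
      using win fin by (auto simp: S_def S'_def)
    define u v where "u = cyl_prob S \<alpha>" and "v = cyl_prob S' \<beta>"
    have uv: "u > 0" "v > 0" unfolding u_def v_def using T cyl_prob_pos by auto
    define x y where "x = cyl_prob T \<alpha> / u" and "y = cyl_prob T' \<beta> / v"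
    define x' y' where "x' = cyl_prob T (\<alpha>(i := b)) / u" and "y' = cyl_prob T' (\<beta>(i := b)) / v"
    define e where "e = 2 * r ^ n"
    have xy: "\<bar>x - y\<bar> \<le> e"
      unfolding x_def y_def u_def v_def e_def T(1,2)
    proof (rule decay)
      show "{i - int n..i + int n} - {i} \<subseteq> S \<inter> S'" using win by (auto simp: S_def S'_def)
    qed (use T agree in auto)
    \<comment> \<open>The flipped symbol has the complementary conditional probabilities, so these
      differ by at most \<open>e\<close> as well.\<close>
    have sum1: "x + x' = 1" "y + y' = 1"
      using cyl_prob_flip[of S i \<alpha>] cyl_prob_flip[of S' i \<beta>] T uv
      by (auto simp: x_def x'_def y_def y'_def u_def v_def b[symmetric] add_divide_distrib[symmetric])
    have "cyl_prob S (\<alpha>(i := b)) = u"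
      unfolding u_def using T by (intro arg_cong[where f = "measure P"] cylinder_cong) auto
    hence lower: "\<delta> \<le> y" "\<delta> \<le> x'"
      using energy[of S' i \<beta>] energy[of S i "\<alpha>(i := b)"] T uv
      by (auto simp: y_def x'_def v_def pos_le_divide_eq)
    have e: "0 \<le> e" using r_pos by (simp add: e_def)
    \<comment> \<open>The lower bound \<open>\<delta>\<close> turns the additive error
      \<open>e\<close> into a factor \<open>exp (e / \<delta>)\<close>. The flipped symbol yields a
      second such factor, whence \<open>4 / \<delta>\<close> with
      \<open>e = 2 * r ^ n\<close>.\<close>
    have A: "x \<le> exp (e / \<delta>) * y"
    proof -
      have "x \<le> y + e" using xy by simp
      also have "e \<le> e / \<delta> * y"
        using mult_left_mono[OF lower(1) e] delta_pos by (simp add: field_simps)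
      hence "y + e \<le> (1 + e / \<delta>) * y" by (simp add: distrib_right)
      also have "\<dots> \<le> exp (e / \<delta>) * y"
        using lower delta_pos by (intro mult_right_mono) auto
      finally show ?thesis .
    qed
    have B: "y' \<le> exp (e / \<delta>) * x'"
    proof -
      have "y' \<le> x' + e" using xy sum1 by simp
      also have "e \<le> e / \<delta> * x'"
        using mult_left_mono[OF lower(2) e] delta_pos by (simp add: field_simps)
      hence "x' + e \<le> (1 + e / \<delta>) * x'" by (simp add: distrib_right)
      also have "\<dots> \<le> exp (e / \<delta>) * x'"
        using lower delta_pos by (intro mult_right_mono) auto
      finally show ?thesis .
    qed
    have "x * y' \<le> (exp (e / \<delta>) * y) * (exp (e / \<delta>) * x')"
      using lower delta_pos uv by (intro mult_mono[OF A B]) (auto simp: y'_def)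
    also have "\<dots> = exp (4 / \<delta> * r ^ n) * (x' * y)"
      by (simp add: e_def mult_ac flip: exp_add mult.assoc)
    finally have "(x * u) * (y' * v) \<le> exp (4 / \<delta> * r ^ n) * ((x' * u) * (y * v))"
      using mult_right_mono[of "x * y'" _ "u * v"] uv by (simp add: mult_ac)
    thus ?thesis
      using uv by (simp add: x_def y_def x'_def y'_def)
  qed
qed

text \<open>The sites of \<open>D\<close> are changed one at a time, in \<open>\<alpha>\<close> and
  \<open>\<beta>\<close> alike, so agreement on every window survives. The probabilities of the
  intermediate configurations cancel as in a telescoping product.\<close>

lemma cyl_prob_override_ratio:
  assumes fin: "finite T" "finite T'" and D: "finite D"
    and win: "\<And>i. i \<in> D \<Longrightarrow> {i - int (d i)..i + int (d i)} \<subseteq> T \<inter> T'"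
    and agree: "\<And>i j. i \<in> D \<Longrightarrow> j \<in> {i - int (d i)..i + int (d i)} \<Longrightarrow> \<alpha> j = \<beta> j"
  shows "cyl_prob T \<alpha> * cyl_prob T' (override_on \<beta> \<gamma> D) \<le>
    exp (\<Sum>i\<in>D. 4 / \<delta> * r ^ d i) * (cyl_prob T (override_on \<alpha> \<gamma> D) * cyl_prob T' \<beta>)"
  using D win agree
proof (induction D rule: finite_induct)
  case (insert i D)
  let ?\<alpha> = "override_on \<alpha> \<gamma> D" and ?\<beta> = "override_on \<beta> \<gamma> D"
  let ?e = "4 / \<delta> * r ^ d i" and ?E = "\<Sum>i\<in>D. 4 / \<delta> * r ^ d i"
  have IH: "cyl_prob T \<alpha> * cyl_prob T' ?\<beta> \<le> exp ?E * (cyl_prob T ?\<alpha> * cyl_prob T' \<beta>)"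
    by (rule insert.IH) (use insert.prems in blast)+
  have flip: "cyl_prob T ?\<alpha> * cyl_prob T' (?\<beta>(i := \<gamma> i)) \<le>
      exp ?e * (cyl_prob T (?\<alpha>(i := \<gamma> i)) * cyl_prob T' ?\<beta>)"
  proof (rule cyl_prob_flip_ratio)
    fix j assume "j \<in> {i - int (d i)..i + int (d i)}"
    hence "\<alpha> j = \<beta> j" using insert.prems(2) by blast
    thus "?\<alpha> j = ?\<beta> j" by (simp add: override_on_def)
  qed (use insert.prems(1) fin in auto)
  have pos: "0 < cyl_prob T ?\<alpha>" "0 < cyl_prob T' ?\<beta>"
    using fin by (auto intro: cyl_prob_pos)
  have "(cyl_prob T \<alpha> * cyl_prob T' ?\<beta>) * (cyl_prob T ?\<alpha> * cyl_prob T' (?\<beta>(i := \<gamma> i))) \<le>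
     (exp ?E * (cyl_prob T ?\<alpha> * cyl_prob T' \<beta>)) *
     (exp ?e * (cyl_prob T (?\<alpha>(i := \<gamma> i)) * cyl_prob T' ?\<beta>))"
    by (rule mult_mono[OF IH flip]) auto
  hence "(cyl_prob T ?\<alpha> * cyl_prob T' ?\<beta>) * (cyl_prob T \<alpha> * cyl_prob T' (?\<beta>(i := \<gamma> i))) \<le>
     (cyl_prob T ?\<alpha> * cyl_prob T' ?\<beta>) *
     (exp (?e + ?E) * (cyl_prob T (?\<alpha>(i := \<gamma> i)) * cyl_prob T' \<beta>))"
    by (simp add: mult_ac exp_add)
  hence "cyl_prob T \<alpha> * cyl_prob T' (?\<beta>(i := \<gamma> i)) \<le>
     exp (?e + ?E) * (cyl_prob T (?\<alpha>(i := \<gamma> i)) * cyl_prob T' \<beta>)"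
    using pos by (subst (asm) mult_le_cancel_left_pos) auto
  thus ?case by (simp only: override_on_insert sum.insert[OF insert.hyps])
qed simp

text \<open>Two geometric tails \<open>4 / \<delta> * r ^ s / (1 - r)\<close>, one for each end of
  an interval with collar \<open>s\<close>; the length of the interval does not enter.\<close>

definition boundary_influence :: "nat \<Rightarrow> real" where
  "boundary_influence s = 8 / \<delta> * r ^ s / (1 - r)"

lemma boundary_influence_nonneg: "0 \<le> boundary_influence s"
  using delta_pos r_pos r_less by (simp add: boundary_influence_def)

lemma sum_power_inj_le:
  assumes "finite I" "inj_on f I"
  shows "(\<Sum>i\<in>I. r ^ f i) \<le> 1 / (1 - r)"
proof -
  have "(\<Sum>i\<in>I. r ^ f i) = (\<Sum>k\<in>f ` I. r ^ k)"
    using assms(2) by (simp add: sum.reindex)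
  also have "\<dots> \<le> (\<Sum>k. r ^ k)"
    using assms(1) r_pos r_less by (intro sum_le_suminf summable_geometric) auto
  also have "\<dots> = 1 / (1 - r)"
    using r_pos r_less by (intro suminf_geometric) auto
  finally show ?thesis .
qed

lemma sum_boundary_influence:
  "(\<Sum>i\<in>{p..q}. 4 / \<delta> * r ^ (nat (min (i - p) (q - i)) + s)) \<le> boundary_influence s"
proof -
  have "r ^ (nat (min (i - p) (q - i)) + s) \<le> r ^ s * (r ^ nat (i - p) + r ^ nat (q - i))" for i
    using r_pos by (auto simp: min_def power_add distrib_left mult.commute)
  hence "(\<Sum>i\<in>{p..q}. 4 / \<delta> * r ^ (nat (min (i - p) (q - i)) + s)) \<le>
      (\<Sum>i\<in>{p..q}. 4 / \<delta> * (r ^ s * (r ^ nat (i - p) + r ^ nat (q - i))))"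
    using delta_pos by (intro sum_mono mult_left_mono) auto
  also have "\<dots> = 4 / \<delta> * r ^ s * ((\<Sum>i\<in>{p..q}. r ^ nat (i - p)) + (\<Sum>i\<in>{p..q}. r ^ nat (q - i)))"
    by (simp only: sum_distrib_left[symmetric] sum.distrib mult.assoc)
  also have "\<dots> \<le> 4 / \<delta> * r ^ s * (1 / (1 - r) + 1 / (1 - r))"
    using delta_pos r_pos by (intro mult_left_mono add_mono sum_power_inj_le) (auto simp: inj_on_def)
  also have "\<dots> = boundary_influence s"
    by (simp add: boundary_influence_def field_simps)
  finally show ?thesis .
qed

text \<open>Summing the cross-ratio bound over one of the two patterns produces the normalising
  constants, so no reference law is needed. For \<open>s = 0\<close> the collar is empty and the
  boundary conditions are arbitrary.\<close>

lemma cyl_exp_ratio: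
  assumes fin: "finite B" "finite B'" and disj: "B \<inter> {p..q} = {}" "B' \<inter> {p..q} = {}"
    and collar: "{p - int s..q + int s} - {p..q} \<subseteq> B \<inter> B'"
    and agree: "\<And>j. j \<in> {p - int s..q + int s} - {p..q} \<Longrightarrow> \<eta> j = \<zeta> j"
    and h: "depends_on {p..q} h" "\<And>\<sigma>. 0 \<le> h \<sigma>"
  shows "cyl_exp B \<eta> h \<le> exp (boundary_influence s) * cyl_exp B' \<zeta> h"
proof -
  let ?W = "{p..q}" and ?E = "exp (boundary_influence s)"
  let ?A = "PiE {p..q} (\<lambda>_. UNIV :: bool set)"
  let ?w = "\<lambda>w. cyl_prob (?W \<union> B) (override_on \<eta> w ?W)"
  let ?w' = "\<lambda>w. cyl_prob (?W \<union> B') (override_on \<zeta> w ?W)"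
  have ratio: "?w a * ?w' b \<le> ?E * (?w b * ?w' a)" for a b
  proof -
    \<comment> \<open>The distance to the nearer end plus \<open>s\<close> is the radius of the
      largest symmetric window inside the collared interval.\<close>
    let ?d = "\<lambda>i. nat (min (i - p) (q - i)) + s"
    have ov: "override_on (override_on \<eta> a ?W) b ?W = override_on \<eta> b ?W"
      "override_on (override_on \<zeta> a ?W) b ?W = override_on \<zeta> b ?W"
      by (auto simp: override_on_def)
    have win: "{i - int (?d i)..i + int (?d i)} \<subseteq> {p - int s..q + int s}" if "i \<in> ?W" for i
      using that by (auto simp: min_def split: if_splits)
    have sub: "{p - int s..q + int s} \<subseteq> (?W \<union> B) \<inter> (?W \<union> B')" using collar by blast
    have "?w a * cyl_prob (?W \<union> B') (override_on (override_on \<zeta> a ?W) b ?W) \<le>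
       exp (\<Sum>i\<in>?W. 4 / \<delta> * r ^ ?d i) *
       (cyl_prob (?W \<union> B) (override_on (override_on \<eta> a ?W) b ?W) * ?w' a)"
    proof (rule cyl_prob_override_ratio)
      fix i j assume "i \<in> ?W" "j \<in> {i - int (?d i)..i + int (?d i)}"
      hence "j \<in> {p - int s..q + int s}" using win by blast
      thus "override_on \<eta> a ?W j = override_on \<zeta> a ?W j"
        using agree[of j] by (auto simp: override_on_def)
    next
      fix i assume "i \<in> ?W"
      thus "{i - int (?d i)..i + int (?d i)} \<subseteq> (?W \<union> B) \<inter> (?W \<union> B')"
        using win sub by blast
    qed (use fin in auto)
    also have "\<dots> \<le> ?E * (?w b * ?w' a)"
      unfolding ov
      by (intro mult_right_mono exp_le_cancel_iff[THEN iffD2] sum_boundary_influence) simp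
    finally show ?thesis unfolding ov .
  qed
  have integral: "(\<integral>\<sigma>. indicator (cylinder C \<xi>) \<sigma> * h \<sigma> \<partial>P) =
      (\<Sum>a\<in>?A. h a * cyl_prob (?W \<union> C) (override_on \<xi> a ?W))"
    if "finite C" "C \<inter> ?W = {}" for C \<xi>
  proof -
    have "(\<integral>\<sigma>. indicator (cylinder (?W \<union> C) (override_on \<xi> a ?W)) \<sigma> * h \<sigma> \<partial>P) =
        h a * cyl_prob (?W \<union> C) (override_on \<xi> a ?W)" for a
    proof -
      have "h (override_on \<xi> a ?W) = h a" by (rule depends_onD[OF h(1)]) auto
      thus ?thesis
        using integral_cylinder_determined[OF depends_on_mono[OF h(1)], of "?W \<union> C" "override_on \<xi> a ?W"] that
        by simp
    qed
    thus ?thesis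
      using that by (subst integral_cylinder_split[of h ?W]) (auto intro: local_funI h(1))
  qed
  have sum: "?w a * cyl_prob B' \<zeta> \<le> ?E * (cyl_prob B \<eta> * ?w' a)" for a
  proof -
    have "?w a * cyl_prob B' \<zeta> = (\<Sum>b\<in>?A. ?w a * ?w' b)"
      using fin disj by (subst cyl_prob_split[of ?W B']) (auto simp: sum_distrib_left)
    also have "\<dots> \<le> (\<Sum>b\<in>?A. ?E * (?w b * ?w' a))" by (intro sum_mono ratio)
    also have "\<dots> = ?E * ((\<Sum>b\<in>?A. ?w b) * ?w' a)"
      by (simp add: sum_distrib_left sum_distrib_right)
    also have "(\<Sum>b\<in>?A. ?w b) = cyl_prob B \<eta>"
      using fin disj by (subst cyl_prob_split[of ?W B]) auto
    finally show ?thesis .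
  qed
  have "(\<Sum>a\<in>?A. h a * ?w a) * cyl_prob B' \<zeta> = (\<Sum>a\<in>?A. h a * (?w a * cyl_prob B' \<zeta>))"
    by (simp add: sum_distrib_right mult.assoc)
  also have "\<dots> \<le> (\<Sum>a\<in>?A. h a * (?E * (cyl_prob B \<eta> * ?w' a)))"
    by (intro sum_mono mult_left_mono sum h(2))
  also have "\<dots> = ?E * cyl_prob B \<eta> * (\<Sum>a\<in>?A. h a * ?w' a)"
    by (simp add: sum_distrib_left mult_ac)
  finally have le: "(\<Sum>a\<in>?A. h a * ?w a) * cyl_prob B' \<zeta> \<le>
    ?E * cyl_prob B \<eta> * (\<Sum>a\<in>?A. h a * ?w' a)" .
  have "cyl_exp B \<eta> h = (\<Sum>a\<in>?A. h a * ?w a) / cyl_prob B \<eta>"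
    "cyl_exp B' \<zeta> h = (\<Sum>a\<in>?A. h a * ?w' a) / cyl_prob B' \<zeta>"
    using integral fin disj by (simp_all add: cyl_exp_def)
  moreover have "x / a \<le> ?E * (y / b)" if "x * b \<le> ?E * a * y" "0 < a" "0 < b" for x y a b :: real
    using that by (simp add: field_simps)
  ultimately show ?thesis
    using le cyl_prob_pos[OF fin(1), of \<eta>] cyl_prob_pos[OF fin(2), of \<zeta>] by simp
qed

end

subsection \<open>Mixing\<close>

lemma power_le_inverse_power4:
  fixes x :: real
  assumes "0 < x" "x < 1"
  obtains C where "0 \<le> C" "\<And>m. x ^ m \<le> C / (real m + 1) ^ 4"
proof -
  \<comment> \<open>Fourth powers turn the boundedness of \<open>n * y ^ n\<close> into the claim;
    dividing by \<open>x\<close> compensates for the shift from \<open>m\<close> to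
    \<open>m + 1\<close>.\<close>
  define y where "y = root 4 x"
  have y: "0 < y" "y < 1" "y ^ 4 = x"
    using assms by (auto simp: y_def)
  have "(\<lambda>n. real n * y ^ n) \<longlonglongrightarrow> 0"
    using y by (intro powser_times_n_limit_0) auto
  hence "Bseq (\<lambda>n. real n * y ^ n)" by (intro convergent_imp_Bseq convergentI)
  then obtain c where c: "0 < c" "\<And>n. \<bar>real n * y ^ n\<bar> \<le> c"
    by (auto simp: Bseq_def)
  have "x ^ m \<le> c ^ 4 / x / (real m + 1) ^ 4" for m
  proof -
    have "(real (Suc m) * y ^ Suc m) ^ 4 \<le> c ^ 4"
      using c(2)[of "Suc m"] y by (intro power_mono) auto
    also have "(real (Suc m) * y ^ Suc m) ^ 4 = (real m + 1) ^ 4 * x ^ Suc m"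
      using y(3) by (metis add.commute of_nat_Suc power_commutes power_mult power_mult_distrib mult.commute)
    finally show ?thesis using assms by (simp add: field_simps)
  qed
  thus ?thesis using assms c(1) by (intro that[of "c ^ 4 / x"]) auto
qed

context quasi_local_law
begin

text \<open>A bound on the total variation distance of the conditional laws at depth
  \<open>n\<close>, uniform in the interval and in both boundary conditions. One sign suffices
  because the two boundary conditions can be exchanged.\<close>

definition mixing_bound :: "nat \<Rightarrow> real \<Rightarrow> bool" where
  "mixing_bound n v \<longleftrightarrow> (\<forall>p q B B' \<eta> \<zeta> h.
     finite B \<longrightarrow> finite B' \<longrightarrow> B \<inter> {p..q} = {} \<longrightarrow> B' \<inter> {p..q} = {} \<longrightarrow>
     depends_on {p + int n..q - int n} h \<longrightarrow> (\<forall>\<sigma>. 0 \<le> h \<sigma> \<and> h \<sigma> \<le> 1) \<longrightarrow>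
     cyl_exp B \<eta> h - cyl_exp B' \<zeta> h \<le> v)"

lemma mixing_boundD:
  assumes "mixing_bound n v" "finite B" "finite B'" "B \<inter> {p..q} = {}" "B' \<inter> {p..q} = {}"
    "depends_on {p + int n..q - int n} h" "\<And>\<sigma>. 0 \<le> h \<sigma>" "\<And>\<sigma>. h \<sigma> \<le> 1"
  shows "cyl_exp B \<eta> h - cyl_exp B' \<zeta> h \<le> v"
  using assms unfolding mixing_bound_def by metis

lemma mixing_bound_0: "mixing_bound 0 1"
  unfolding mixing_bound_def
proof (intro allI impI)
  fix p q :: int and B B' :: "int set" and \<eta> \<zeta> :: "int \<Rightarrow> bool" and h :: "(int \<Rightarrow> bool) \<Rightarrow> real"
  assume fin: "finite B" "finite B'" and dep: "depends_on {p + int 0..q - int 0} h"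
    and h: "\<forall>\<sigma>. 0 \<le> h \<sigma> \<and> h \<sigma> \<le> 1"
  have "local_fun h" using dep by (auto intro: local_funI)
  thus "cyl_exp B \<eta> h - cyl_exp B' \<zeta> h \<le> 1"
    using cyl_exp_bounds(2)[of h B 0 1 \<eta>] cyl_exp_bounds(1)[of h B' 0 1 \<zeta>] fin h by force
qed

lemma mixing_bound_mono:
  assumes "mixing_bound n v" "n \<le> m" "v \<le> w"
  shows "mixing_bound m w"
  unfolding mixing_bound_def
proof (intro allI impI)
  fix p q :: int and B B' :: "int set" and \<eta> \<zeta> :: "int \<Rightarrow> bool" and h :: "(int \<Rightarrow> bool) \<Rightarrow> real"
  assume *: "finite B" "finite B'" "B \<inter> {p..q} = {}" "B' \<inter> {p..q} = {}"
    "depends_on {p + int m..q - int m} h" "\<forall>\<sigma>. 0 \<le> h \<sigma> \<and> h \<sigma> \<le> 1"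
  have "depends_on {p + int n..q - int n} h"
    using *(5) by (rule depends_on_mono) (use assms(2) in auto)
  hence "cyl_exp B \<eta> h - cyl_exp B' \<zeta> h \<le> v"
    using * assms(1) by (intro mixing_boundD) auto
  thus "cyl_exp B \<eta> h - cyl_exp B' \<zeta> h \<le> w" using assms(3) by simp
qed

text \<open>
  The laws of the collar of width \<open>s\<close> under two boundary conditions have density bounded below
  by \<open>exp (- boundary_influence 0)\<close> with respect to each other, which contracts the oscillation;
  once the collar is fixed, the boundary matters only by a factor \<open>exp (boundary_influence s)\<close>.
\<close>

lemma mixing_bound_step:
  assumes mix: "mixing_bound n v"
  shows "mixing_bound (n + s)
    ((1 - exp (- boundary_influence 0)) * v + (exp (boundary_influence s) - 1))"
  unfolding mixing_bound_def
proof (intro allI impI)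
  fix p q :: int and B B' :: "int set" and \<eta> \<zeta> :: "int \<Rightarrow> bool" and h :: "(int \<Rightarrow> bool) \<Rightarrow> real"
  assume fin: "finite B" "finite B'" and disj: "B \<inter> {p..q} = {}" "B' \<inter> {p..q} = {}"
    and dep: "depends_on {p + int (n + s)..q - int (n + s)} h"
    and h: "\<forall>\<sigma>. 0 \<le> h \<sigma> \<and> h \<sigma> \<le> 1"
  define A where "A = {p..q} - {p + int s..q - int s}"
  have A: "finite A" "A \<subseteq> {p..q}" by (auto simp: A_def)
  hence A': "A \<inter> B = {}" "A \<inter> B' = {}" using disj by blast+
  have loc: "local_fun h" using dep by (auto intro: local_funI)
  define H where "H = (\<lambda>\<sigma>. cyl_exp (A \<union> B) (override_on \<eta> \<sigma> A) h)"
  define H' where "H' = (\<lambda>\<sigma>. cyl_exp (A \<union> B') (override_on \<zeta> \<sigma> A) h)"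
  have tower: "cyl_exp B \<eta> h = cyl_exp B \<eta> H" "cyl_exp B' \<zeta> h = cyl_exp B' \<zeta> H'"
    and depH: "depends_on A H" "depends_on A H'"
    unfolding H_def H'_def using cyl_exp_tower loc A A' fin by auto
  have locH: "local_fun H" "local_fun H'" using depH A(1) by (auto intro: local_funI)
  let ?e = "exp (boundary_influence s) - 1"
  have H'_bounds: "0 \<le> H' \<sigma>" "H' \<sigma> \<le> 1" for \<sigma>
    unfolding H'_def using loc A fin h by (auto intro!: cyl_exp_bounds)
  have near: "H \<sigma> \<le> H' \<sigma> + ?e" for \<sigma>
  proof -
    have "H \<sigma> \<le> exp (boundary_influence s) * H' \<sigma>"
      unfolding H_def H'_def
    proof (rule cyl_exp_ratio[of _ _ "p + int s" "q - int s"])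
      show "depends_on {p + int s..q - int s} h"
        by (rule depends_on_mono[OF dep]) auto
      show "{p + int s - int s..q - int s + int s} - {p + int s..q - int s} \<subseteq> (A \<union> B) \<inter> (A \<union> B')"
        by (auto simp: A_def)
      fix j assume "j \<in> {p + int s - int s..q - int s + int s} - {p + int s..q - int s}"
      hence "j \<in> A" by (simp add: A_def)
      thus "override_on \<eta> \<sigma> A j = override_on \<zeta> \<sigma> A j" by simp
    qed (use A fin disj h in \<open>auto simp: A_def\<close>)
    also have "\<dots> = H' \<sigma> + ?e * H' \<sigma>" by (simp add: algebra_simps)
    also have "?e * H' \<sigma> \<le> ?e"
      using H'_bounds[of \<sigma>] boundary_influence_nonneg[of s] by (intro mult_left_le) auto
    finally show ?thesis by simp
  qed
  have osc: "H' \<sigma> - H' \<tau> \<le> v" for \<sigma> \<tau>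
    unfolding H'_def
    using A fin disj h dep
    by (intro mixing_boundD[OF mix, of _ _ "p + int s" "q - int s"])
      (auto simp: A_def algebra_simps)
  \<comment> \<open>Subtracting the infimum makes \<open>H' - c\<close> nonnegative, as
    \<open>cyl_exp_ratio\<close> requires, and at most \<open>v\<close>. The two means of this
    function then differ by at most a fraction \<open>1 - exp (- boundary_influence 0)\<close> of
    \<open>v\<close>.\<close>
  define c where "c = (INF \<sigma>. H' \<sigma>)"
  have bdd: "bdd_below (range H')" using H'_bounds(1) by (auto intro: bdd_belowI[of _ 0])
  have lower: "c \<le> H' \<sigma>" for \<sigma> unfolding c_def using bdd by (rule cINF_lower) simp
  have upper: "H' \<sigma> - v \<le> c" for \<sigma>
    unfolding c_def using osc[of \<sigma>] by (intro cINF_greatest) (auto simp: algebra_simps)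
  let ?G = "\<lambda>\<sigma>. 1 * H' \<sigma> + (- c)"
  have locG: "local_fun ?G" using locH(2) by (rule local_fun_comp)
  have "cyl_exp B \<eta> ?G \<le> exp (boundary_influence 0) * cyl_exp B' \<zeta> ?G"
  proof (rule cyl_exp_ratio)
    have "depends_on A ?G" using depH(2) by (rule depends_on_comp)
    thus "depends_on {p..q} ?G" using A(2) by (rule depends_on_mono)
  qed (use fin disj lower in auto)
  hence "exp (- boundary_influence 0) * cyl_exp B \<eta> ?G \<le> cyl_exp B' \<zeta> ?G"
    by (simp add: exp_minus field_simps)
  moreover have "cyl_exp B \<eta> ?G \<le> v"
    using upper by (intro cyl_exp_bounds(2)[OF locG fin(1), of "0"]) (auto simp: lower algebra_simps)
  moreover have "exp (- boundary_influence 0) \<le> 1" using boundary_influence_nonneg by simp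
  ultimately have "cyl_exp B \<eta> ?G - cyl_exp B' \<zeta> ?G \<le> (1 - exp (- boundary_influence 0)) * v"
    using mult_left_mono[of "cyl_exp B \<eta> ?G" v "1 - exp (- boundary_influence 0)"]
    by (simp add: algebra_simps)
  moreover have "cyl_exp B \<eta> H \<le> cyl_exp B \<eta> (\<lambda>\<sigma>. 1 * H' \<sigma> + ?e)"
    using near locH fin(1) by (intro cyl_exp_mono) (auto intro: local_fun_comp)
  hence "cyl_exp B \<eta> H \<le> cyl_exp B \<eta> H' + ?e"
    using cyl_exp_affine[OF locH(2) fin(1), of \<eta> 1 ?e] by simp
  ultimately show "cyl_exp B \<eta> h - cyl_exp B' \<zeta> h \<le>
      (1 - exp (- boundary_influence 0)) * v + (exp (boundary_influence s) - 1)"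
    using cyl_exp_affine[OF locH(2) fin(1), of \<eta> 1 "- c"] cyl_exp_affine[OF locH(2) fin(2), of \<zeta> 1 "- c"]
    unfolding tower by simp
qed

text \<open>The second summand is the fixed point of the affine recursion in
  \<open>mixing_bound_step\<close>: the geometric series with ratio
  \<open>1 - exp (- boundary_influence 0)\<close> sums to
  \<open>exp (boundary_influence 0)\<close>.\<close>

lemma mixing_bound_iterate:
  "mixing_bound (k * s) ((1 - exp (- boundary_influence 0)) ^ k +
     exp (boundary_influence 0) * (exp (boundary_influence s) - 1))"
proof (induction k)
  case 0
  have "1 \<le> (1 :: real) + exp (boundary_influence 0) * (exp (boundary_influence s) - 1)"
    using boundary_influence_nonneg[of s] by simp
  thus ?case using mixing_bound_mono[OF mixing_bound_0, of 0] by simp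
next
  case (Suc k)
  let ?b = "boundary_influence 0" and ?e = "exp (boundary_influence s) - 1"
  have "(1 - exp (- ?b)) * ((1 - exp (- ?b)) ^ k + exp ?b * ?e) + ?e =
      (1 - exp (- ?b)) ^ Suc k + exp ?b * ?e + (1 - exp (- ?b) * exp ?b) * ?e"
    by (simp add: algebra_simps)
  also have "exp (- ?b) * exp ?b = 1" by (simp flip: exp_add)
  finally show ?case using mixing_bound_step[OF Suc.IH, of s] by (simp add: add.commute)
qed

text \<open>The depth \<open>n\<close> is divided into \<open>m\<close> collars of width
  \<open>m\<close>, with \<open>m\<close> the integer square root. Both error terms are then
  controlled by \<open>x ^ m\<close>, and fourth-power decay in \<open>m\<close> is square decay in
  \<open>n\<close>.\<close>

lemma mixing_bound_inverse_square:
  obtains C where "0 \<le> C" "\<And>n. mixing_bound n (C / (real n + 1)\<^sup>2)"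
proof -
  define b where "b = boundary_influence 0"
  have b: "0 < b" using delta_pos r_less by (simp add: b_def boundary_influence_def)
  define \<theta> where "\<theta> = 1 - exp (- b)"
  have \<theta>: "0 < \<theta>" "\<theta> < 1" using b by (auto simp: \<theta>_def)
  define x where "x = max \<theta> r"
  have x: "0 < x" "x < 1" using \<theta> r_pos r_less by (auto simp: x_def)
  obtain C where C: "0 \<le> C" "\<And>m. x ^ m \<le> C / (real m + 1) ^ 4"
    using power_le_inverse_power4[OF x] by blast
  define D where "D = 1 + exp b * (exp b * b)"
  have D: "0 \<le> D" using b by (simp add: D_def)
  have bound: "mixing_bound n (D * C / (real n + 1)\<^sup>2)" for n
  proof -
    define m where "m = floor_sqrt n"
    have "n < (m + 1)\<^sup>2" using Suc_floor_sqrt_power2_gt[of n] by (simp add: m_def)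
    hence "real n + 1 \<le> (real m + 1)\<^sup>2"
      by (metis Suc_leI Suc_eq_plus1 of_nat_Suc of_nat_le_iff of_nat_power add.commute)
    hence "(real n + 1)\<^sup>2 \<le> ((real m + 1)\<^sup>2)\<^sup>2" by (intro power_mono) auto
    hence sq: "(real n + 1)\<^sup>2 \<le> (real m + 1) ^ 4" by (simp flip: power_mult)
    have s: "boundary_influence m = b * r ^ m" by (simp add: b_def boundary_influence_def)
    have rm: "r ^ m \<le> 1" using r_pos r_less by (intro power_le_one) auto
    \<comment> \<open>This is \<open>exp u - 1 \<le> u * exp u\<close> for
      \<open>u = b * r ^ m\<close>, combined with \<open>u \<le> b\<close>.\<close>
    have e: "exp (boundary_influence m) - 1 \<le> exp b * b * r ^ m"
    proof -
      have "1 - b * r ^ m \<le> exp (- (b * r ^ m))" using exp_ge_add_one_self[of "- (b * r ^ m)"] by simp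
      hence "exp (b * r ^ m) * (1 - b * r ^ m) \<le> exp (b * r ^ m) * exp (- (b * r ^ m))"
        by (intro mult_left_mono) auto
      also have "\<dots> = 1" by (simp flip: exp_add)
      finally have "exp (b * r ^ m) - 1 \<le> exp (b * r ^ m) * (b * r ^ m)" by (simp add: algebra_simps)
      also have "\<dots> \<le> exp b * (b * r ^ m)"
        using b rm r_pos by (intro mult_right_mono) (auto intro: mult_left_le)
      finally show ?thesis by (simp add: s mult.assoc)
    qed
    have "\<theta> ^ m + exp b * (exp (boundary_influence m) - 1) \<le> \<theta> ^ m + exp b * (exp b * b * r ^ m)"
      using e by simp
    also have "\<dots> \<le> x ^ m + exp b * (exp b * b * x ^ m)"
      using b \<theta> r_pos by (intro add_mono mult_left_mono power_mono) (auto simp: x_def)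
    also have "\<dots> = D * x ^ m" by (simp add: D_def algebra_simps)
    also have "\<dots> \<le> D * (C / (real m + 1) ^ 4)" using C D by (intro mult_left_mono) auto
    also have "\<dots> \<le> D * (C / (real n + 1)\<^sup>2)"
      using sq C D by (intro mult_left_mono divide_left_mono) auto
    finally have "\<theta> ^ m + exp b * (exp (boundary_influence m) - 1) \<le> D * C / (real n + 1)\<^sup>2" by simp
    moreover have "m * m \<le> n" unfolding m_def using floor_sqrt_power2_le[of n] by (simp add: power2_eq_square)
    ultimately show ?thesis
      using mixing_bound_mono[OF mixing_bound_iterate[of m m]] by (simp add: \<theta>_def b_def)
  qed
  show ?thesis using that[of "D * C"] bound C D by simp
qed

end

subsection \<open>Gaussian concentration\<close>

text \<open>Factoring out the smaller exponential reduces the claim to the logarithmic form in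
  \<open>Hoeffdings_lemma_aux\<close>; exchanging the two points, and \<open>q\<close> with
  \<open>1 - q\<close>, covers the other order.\<close>

lemma Hoeffding_two_point:
  fixes q a b \<theta> D :: real
  assumes q: "0 \<le> q" "q \<le> 1" and D: "\<bar>a - b\<bar> \<le> D"
  shows "q * exp (\<theta> * a) + (1 - q) * exp (\<theta> * b) \<le> exp (\<theta> * (q * a + (1 - q) * b) + \<theta>\<^sup>2 * D\<^sup>2 / 8)"
proof -
  have *: "p * exp u + (1 - p) * exp v \<le> exp (p * u + (1 - p) * v + (u - v)\<^sup>2 / 8)"
    if p: "0 \<le> p" and uv: "v \<le> u" for p u v :: real
  proof -
    have pos: "0 < 1 + p * (exp (u - v) - 1)"
      using p uv by (simp add: add_pos_nonneg)
    have "ln (1 + p * (exp (u - v) - 1)) \<le> (u - v) * p + (u - v)\<^sup>2 / 8"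
      using Hoeffdings_lemma_aux[of "u - v" p] p uv by (simp add: algebra_simps)
    hence "1 + p * (exp (u - v) - 1) \<le> exp ((u - v) * p + (u - v)\<^sup>2 / 8)"
      using pos by (simp add: ln_le_cancel_iff[symmetric] del: ln_le_cancel_iff)
    hence "exp v * (1 + p * (exp (u - v) - 1)) \<le> exp v * exp ((u - v) * p + (u - v)\<^sup>2 / 8)"
      by simp
    also have "\<dots> = exp (p * u + (1 - p) * v + (u - v)\<^sup>2 / 8)"
      unfolding exp_add[symmetric] by (simp add: algebra_simps)
    also have "exp v * (1 + p * (exp (u - v) - 1)) = p * (exp v * exp (u - v)) + (1 - p) * exp v"
      by (simp add: algebra_simps)
    also have "exp v * exp (u - v) = exp u" by (simp flip: exp_add)
    finally show ?thesis .
  qed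
  have "q * exp (\<theta> * a) + (1 - q) * exp (\<theta> * b) \<le>
      exp (q * (\<theta> * a) + (1 - q) * (\<theta> * b) + (\<theta> * a - \<theta> * b)\<^sup>2 / 8)"
  proof (cases "\<theta> * b \<le> \<theta> * a")
    case True
    thus ?thesis using *[OF q(1)] by simp
  next
    case False
    thus ?thesis using *[of "1 - q" "\<theta> * a" "\<theta> * b"] q by (simp add: power2_commute algebra_simps)
  qed
  also have "(\<theta> * a - \<theta> * b)\<^sup>2 = \<theta>\<^sup>2 * (a - b)\<^sup>2"
    by (simp add: power2_eq_square algebra_simps)
  also have "exp (q * (\<theta> * a) + (1 - q) * (\<theta> * b) + \<theta>\<^sup>2 * (a - b)\<^sup>2 / 8) \<le>
      exp (q * (\<theta> * a) + (1 - q) * (\<theta> * b) + \<theta>\<^sup>2 * D\<^sup>2 / 8)"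
    using D by (auto intro!: mult_left_mono simp: abs_le_square_iff[symmetric])
  also have "q * (\<theta> * a) + (1 - q) * (\<theta> * b) = \<theta> * (q * a + (1 - q) * b)"
    by (simp add: algebra_simps)
  finally show ?thesis .
qed

definition coord_lipschitz :: "real \<Rightarrow> ((int \<Rightarrow> bool) \<Rightarrow> real) \<Rightarrow> bool" where
  "coord_lipschitz c f \<longleftrightarrow> (\<forall>\<sigma> i b. \<bar>f (\<sigma>(i := b)) - f \<sigma>\<bar> \<le> c)"

lemma coord_lipschitzD: "coord_lipschitz c f \<Longrightarrow> \<bar>f (\<sigma>(i := b)) - f \<sigma>\<bar> \<le> c"
  by (simp add: coord_lipschitz_def)

lemma coord_lipschitz_nonneg: "coord_lipschitz c f \<Longrightarrow> 0 \<le> c"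
  using coord_lipschitzD[of c f undefined undefined undefined] by linarith

lemma coord_lipschitz_uminus: "coord_lipschitz c f \<Longrightarrow> coord_lipschitz c (\<lambda>\<sigma>. - f \<sigma>)"
  unfolding coord_lipschitz_def by (simp add: abs_minus_commute)

lemma coord_lipschitz_override:
  assumes "coord_lipschitz c f"
  shows "coord_lipschitz c (\<lambda>\<sigma>. f (override_on \<sigma> \<zeta> A))"
  unfolding coord_lipschitz_def
proof (intro allI)
  fix \<sigma> :: "int \<Rightarrow> bool" and i b
  have "override_on (\<sigma>(i := b)) \<zeta> A = (if i \<in> A then override_on \<sigma> \<zeta> A else (override_on \<sigma> \<zeta> A)(i := b))"
    by (auto simp: override_on_def fun_eq_iff)
  thus "\<bar>f (override_on (\<sigma>(i := b)) \<zeta> A) - f (override_on \<sigma> \<zeta> A)\<bar> \<le> c"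
    using coord_lipschitzD[OF assms] coord_lipschitz_nonneg[OF assms] by (cases "i \<in> A") simp_all
qed

section \<open>Martingale differences and exponential moments\<close>

context quasi_local_law
begin

lemma cyl_exp_determined:
  assumes "depends_on B h" "finite B"
  shows "cyl_exp B \<eta> h = h \<eta>"
  using cyl_prob_pos[OF assms(2), of \<eta>] by (simp add: cyl_exp_def integral_cylinder_determined[OF assms])

text \<open>One weight \<open>q\<close>, the conditional probability of \<open>True\<close> at
  \<open>i\<close>, serves every \<open>h\<close>; it is applied both to \<open>f\<close> and to
  \<open>exp (\<theta> * f)\<close>.\<close>

lemma cyl_exp_split_site:
  assumes "finite B" "i \<notin> B"
  obtains q where "0 \<le> q" "q \<le> 1"
    "\<And>h. local_fun h \<Longrightarrow> cyl_exp B \<eta> h =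
       q * cyl_exp (insert i B) (\<eta>(i := True)) h + (1 - q) * cyl_exp (insert i B) (\<eta>(i := False)) h"
proof -
  define q where "q = cyl_prob (insert i B) (\<eta>(i := True)) / cyl_prob B \<eta>"
  have pos: "0 < cyl_prob B \<eta>" "0 < cyl_prob (insert i B) (\<eta>(i := True))"
    "0 < cyl_prob (insert i B) (\<eta>(i := False))"
    using assms cyl_prob_pos by auto
  have "cyl_prob (insert i B) (\<eta>(i := True)) + cyl_prob (insert i B) (\<eta>(i := False)) = cyl_prob B \<eta>"
  proof -
    have "cylinder B (\<eta>(i := True)) = cylinder B \<eta>" using assms(2) by (intro cylinder_cong) auto
    thus ?thesis using cyl_prob_flip[OF assms, of "\<eta>(i := True)"] by simp
  qed
  hence q: "1 - q = cyl_prob (insert i B) (\<eta>(i := False)) / cyl_prob B \<eta>"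
    using pos by (simp add: q_def field_simps)
  show ?thesis
  proof (rule that[of q])
    show "0 \<le> q" by (simp add: q_def)
    show "q \<le> 1" using q pos by (smt (verit) divide_pos_pos)
    fix h :: "(int \<Rightarrow> bool) \<Rightarrow> real" assume h: "local_fun h"
    have "indicator (cylinder B \<eta>) \<sigma> * h \<sigma> =
        indicator (cylinder (insert i B) (\<eta>(i := True))) \<sigma> * h \<sigma> +
        indicator (cylinder (insert i B) (\<eta>(i := False))) \<sigma> * h \<sigma>" for \<sigma>
      using assms(2) by (cases "\<sigma> i") (auto simp: indicator_def cylinder_def)
    hence "(\<integral>\<sigma>. indicator (cylinder B \<eta>) \<sigma> * h \<sigma> \<partial>P) =
        (\<integral>\<sigma>. indicator (cylinder (insert i B) (\<eta>(i := True))) \<sigma> * h \<sigma> \<partial>P) +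
        (\<integral>\<sigma>. indicator (cylinder (insert i B) (\<eta>(i := False))) \<sigma> * h \<sigma> \<partial>P)"
      using assms(1) h by (simp only: Bochner_Integration.integral_add local_fun_integrable_cylinder finite_insert)
    thus "cyl_exp B \<eta> h =
       q * cyl_exp (insert i B) (\<eta>(i := True)) h + (1 - q) * cyl_exp (insert i B) (\<eta>(i := False)) h"
      unfolding q cyl_exp_def using pos by (simp add: q_def add_divide_distrib)
  qed
qed

lemma mixing_bounded:
  assumes mix: "mixing_bound n v" and fin: "finite B" "finite B'"
    and sub: "B \<subseteq> {..p}" "B' \<subseteq> {..p}"
    and dep: "depends_on {p + 1 + int n..m} h" and h: "\<And>\<sigma>. \<bar>h \<sigma>\<bar> \<le> c"
  shows "cyl_exp B \<eta> h - cyl_exp B' \<zeta> h \<le> 2 * c * v"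
proof (cases "c = 0")
  case True
  hence "h = (\<lambda>_. 0)" using h by force
  thus ?thesis using True by (simp add: cyl_exp_def)
next
  case False
  hence c: "c > 0" using h[of undefined] by linarith
  have loc: "local_fun h" using dep by (auto intro: local_funI)
  \<comment> \<open>This maps \<open>[-c, c]\<close> into \<open>[0, 1]\<close>; undoing the scaling
    gives the factor \<open>2 * c\<close>.\<close>
  let ?k = "\<lambda>\<sigma>. 1 / (2 * c) * h \<sigma> + 1 / 2"
  have "cyl_exp B \<eta> ?k - cyl_exp B' \<zeta> ?k \<le> v"
  \<comment> \<open>Since \<open>B\<close> and \<open>B'\<close> lie to the left, the interval can
    be extended by \<open>n\<close> to the right of \<open>m\<close>, so only the gap on the left
    matters.\<close>
  proof (rule mixing_boundD[OF mix fin, of "p + 1" "m + int n"])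
    show "depends_on {p + 1 + int n..m + int n - int n} ?k"
      using depends_on_comp[OF dep] by simp
    fix \<sigma>
    show "0 \<le> ?k \<sigma>" "?k \<sigma> \<le> 1" using h[of \<sigma>] c by (auto simp: field_simps)
  qed (use sub in force)+
  hence "(1 / (2 * c) * cyl_exp B \<eta> h + 1 / 2) - (1 / (2 * c) * cyl_exp B' \<zeta> h + 1 / 2) \<le> v"
    unfolding cyl_exp_affine[OF loc fin(1)] cyl_exp_affine[OF loc fin(2)] .
  hence "(cyl_exp B \<eta> h - cyl_exp B' \<zeta> h) / (2 * c) \<le> v" by (simp add: diff_divide_distrib)
  thus ?thesis using c by (simp add: pos_divide_le_eq mult.commute)
qed

text \<open>Mixing applied to \<open>g\<close> at once would cost its total oscillation. Freezing
  the coordinate nearest to the boundary splits off \<open>g1\<close>, bounded by \<open>c\<close>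
  and supported at distance \<open>n\<close>; the remainder \<open>g2\<close> is still Lipschitz and
  starts one site further away.\<close>

lemma mixing_lipschitz:
  assumes mix: "\<And>n. mixing_bound n (\<phi> n)" and fin: "finite B" "finite B'"
    and sub: "B \<subseteq> {..p}" "B' \<subseteq> {..p}"
  shows "n \<le> k \<Longrightarrow> depends_on {p + 1 + int n..p + int k} g \<Longrightarrow> coord_lipschitz c g \<Longrightarrow>
    cyl_exp B \<eta> g - cyl_exp B' \<zeta> g \<le> 2 * c * (\<Sum>i = n..<k. \<phi> i)"
proof (induction n arbitrary: g rule: inc_induct)
  case base
  have "g = (\<lambda>_. g undefined)"
    by (rule ext, rule depends_onD[OF base(1)]) auto
  hence "cyl_exp B \<eta> g = g undefined" "cyl_exp B' \<zeta> g = g undefined"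
    using cyl_exp_const fin by metis+
  thus ?case by simp
next
  case (step n)
  define o' :: "int \<Rightarrow> bool" where "o' = (\<lambda>_. False)"
  define g2 where "g2 = (\<lambda>\<sigma>. g (override_on \<sigma> o' {p + 1 + int n}))"
  define g1 where "g1 = (\<lambda>\<sigma>. g \<sigma> - g2 \<sigma>)"
  have dep2: "depends_on ({p + 1 + int n..p + int k} - {p + 1 + int n}) g2"
    unfolding g2_def by (rule depends_on_override[OF step.prems(1)])
  hence dep2': "depends_on {p + 1 + int (Suc n)..p + int k} g2"
    by (rule depends_on_mono) auto
  have "depends_on {p + 1 + int n..p + int k} g2"
    by (rule depends_on_mono[OF dep2]) auto
  hence dep1: "depends_on {p + 1 + int n..p + int k} g1"
    unfolding g1_def by (rule depends_on_comp2[OF step.prems(1)])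
  have loc: "local_fun g1" "local_fun g2"
    using local_funI[OF _ dep1] local_funI[OF _ dep2] by simp_all
  have "\<bar>g1 \<sigma>\<bar> \<le> c" for \<sigma>
  proof -
    have "override_on \<sigma> o' {p + 1 + int n} = \<sigma>(p + 1 + int n := False)"
      by (auto simp: override_on_def o'_def)
    thus ?thesis
      using coord_lipschitzD[OF step.prems(2), of \<sigma> "p + 1 + int n" False]
      unfolding g1_def g2_def by (simp only: abs_minus_commute)
  qed
  hence "cyl_exp B \<eta> g1 - cyl_exp B' \<zeta> g1 \<le> 2 * c * \<phi> n"
    by (intro mixing_bounded[OF mix fin sub dep1])
  moreover have "cyl_exp B \<eta> g2 - cyl_exp B' \<zeta> g2 \<le> 2 * c * (\<Sum>i = Suc n..<k. \<phi> i)"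
    using dep2' step.prems(2) unfolding g2_def
    by (intro step.IH coord_lipschitz_override)
  moreover have "g = (\<lambda>\<sigma>. g1 \<sigma> + g2 \<sigma>)" by (simp add: g1_def)
  hence "cyl_exp C \<xi> g = cyl_exp C \<xi> g1 + cyl_exp C \<xi> g2" if "finite C" for C \<xi>
    using cyl_exp_add[OF loc that] by metis
  ultimately show ?case
    using fin step.hyps by (simp add: sum.atLeast_Suc_lessThan distrib_left)
qed

text \<open>The last revealed symbol acts twice: directly on \<open>f\<close>, which costs
  \<open>c\<close>, and through the law of the unrevealed sites, which costs
  \<open>2 * c * suminf \<phi>\<close>. The result is independent of \<open>M\<close>.\<close>

lemma cyl_exp_site_oscillation:
  assumes mix: "\<And>n. mixing_bound n (\<phi> n)" and \<phi>: "summable \<phi>" "\<And>n. 0 \<le> \<phi> n"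
    and dep: "depends_on {1..int M} f" and lip: "coord_lipschitz c f" and k: "k < M"
  shows "cyl_exp {1..int k + 1} x f - cyl_exp {1..int k + 1} (x(int k + 1 := b)) f \<le>
    c * (1 + 2 * suminf \<phi>)"
proof -
  let ?B = "{1..int k + 1}" and ?x = "x(int k + 1 := b)"
  \<comment> \<open>Freezing the revealed coordinates leaves functions of the future alone, as
    \<open>mixing_lipschitz\<close> requires.\<close>
  let ?f = "\<lambda>\<sigma>. f (override_on \<sigma> x ?B)" and ?f' = "\<lambda>\<sigma>. f (override_on \<sigma> ?x ?B)"
  have loc: "local_fun f" using dep by (auto intro: local_funI)
  have c: "0 \<le> c" using lip by (rule coord_lipschitz_nonneg)
  have "override_on \<sigma> y ?B = \<sigma>" if "\<sigma> \<in> cylinder ?B y" for \<sigma> y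
    using that by (auto simp: cylinder_def override_on_def fun_eq_iff)
  hence eq: "cyl_exp ?B x f = cyl_exp ?B x ?f" "cyl_exp ?B ?x f = cyl_exp ?B ?x ?f'"
    by (auto intro!: cyl_exp_cong)
  have "?f \<sigma> \<le> 1 * ?f' \<sigma> + c" for \<sigma>
  proof -
    have "override_on \<sigma> ?x ?B = (override_on \<sigma> x ?B)(int k + 1 := b)"
      by (auto simp: override_on_def fun_eq_iff)
    thus ?thesis using coord_lipschitzD[OF lip, of "override_on \<sigma> x ?B" "int k + 1" b] by simp
  qed
  hence "cyl_exp ?B ?x ?f \<le> cyl_exp ?B ?x (\<lambda>\<sigma>. 1 * ?f' \<sigma> + c)"
    using loc by (intro cyl_exp_mono) (auto intro: local_fun_override local_fun_comp)
  also have "\<dots> = cyl_exp ?B ?x ?f' + c"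
    using cyl_exp_affine[OF local_fun_override[OF loc], of ?B ?x 1 ?x ?B c] by simp
  finally have 1: "cyl_exp ?B ?x ?f \<le> cyl_exp ?B ?x f + c" by (simp add: eq)
  have "cyl_exp ?B x ?f - cyl_exp ?B ?x ?f \<le> 2 * c * (\<Sum>i = 0..<M. \<phi> i)"
  proof (rule mixing_lipschitz[OF mix])
    show "depends_on {int k + 1 + 1 + int 0..int k + 1 + int M} ?f"
      by (rule depends_on_mono[OF depends_on_override[OF dep]]) auto
    show "coord_lipschitz c ?f" using lip by (rule coord_lipschitz_override)
  qed auto
  also have "\<dots> \<le> 2 * c * suminf \<phi>"
    using c \<phi> by (intro mult_left_mono sum_le_suminf) auto
  finally show ?thesis using 1 eq by (simp add: algebra_simps)
qed

text \<open>The Azuma-Hoeffding argument on cylinders. The induction runs backwards from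
  \<open>k = M\<close>, where \<open>f\<close> is determined, to \<open>k = 0\<close>, where the
  conditional expectation is the expectation; each site costs \<open>\<theta>^2 * D^2 / 8\<close> in
  the exponent.\<close>

lemma exponential_moment:
  assumes mix: "\<And>n. mixing_bound n (\<phi> n)" and \<phi>: "summable \<phi>" "\<And>n. 0 \<le> \<phi> n"
    and dep: "depends_on {1..int M} f" and lip: "coord_lipschitz c f"
  shows "expectation (\<lambda>\<sigma>. exp (\<theta> * (f \<sigma> - expectation f))) \<le>
    exp (real M * (\<theta>\<^sup>2 * (c * (1 + 2 * suminf \<phi>))\<^sup>2 / 8))"
proof -
  define D where "D = c * (1 + 2 * suminf \<phi>)"
  have loc: "local_fun f" using dep by (auto intro: local_funI)
  have loce: "local_fun (\<lambda>\<sigma>. exp (\<theta> * f \<sigma>))" using loc by (rule local_fun_comp)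
  have "cyl_exp {1..int k} x (\<lambda>\<sigma>. exp (\<theta> * f \<sigma>)) \<le>
      exp (\<theta> * cyl_exp {1..int k} x f + real (M - k) * (\<theta>\<^sup>2 * D\<^sup>2 / 8))" if "k \<le> M" for k x
    using that
  proof (induction k arbitrary: x rule: inc_induct)
    case base
    show ?case by (simp add: cyl_exp_determined dep depends_on_comp[OF dep, of "\<lambda>u. exp (\<theta> * u)"])
  next
    case (step k)
    let ?B = "{1..int k}" and ?B' = "{1..int (Suc k)}"
    have B': "insert (int k + 1) ?B = ?B'" by auto
    define y z where "y = x(int k + 1 := True)" and "z = x(int k + 1 := False)"
    obtain q where q: "0 \<le> q" "q \<le> 1"
      and split: "\<And>h. local_fun h \<Longrightarrow> cyl_exp ?B x h = q * cyl_exp ?B' y h + (1 - q) * cyl_exp ?B' z h"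
      using cyl_exp_split_site[of ?B "int k + 1" x] unfolding B' y_def z_def by auto
    let ?R = "real (M - Suc k) * (\<theta>\<^sup>2 * D\<^sup>2 / 8)"
    have osc: "\<bar>cyl_exp ?B' y f - cyl_exp ?B' z f\<bar> \<le> D"
    proof -
      have "y = z(int k + 1 := True)" "z = y(int k + 1 := False)" by (simp_all add: y_def z_def)
      hence "cyl_exp ?B' y f - cyl_exp ?B' z f \<le> D" "cyl_exp ?B' z f - cyl_exp ?B' y f \<le> D"
        using cyl_exp_site_oscillation[OF mix \<phi> dep lip, of k y False]
          cyl_exp_site_oscillation[OF mix \<phi> dep lip, of k z True] step.hyps
        by (simp_all add: D_def add.commute)
      thus ?thesis by linarith
    qed
    have "cyl_exp ?B x (\<lambda>\<sigma>. exp (\<theta> * f \<sigma>)) =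
        q * cyl_exp ?B' y (\<lambda>\<sigma>. exp (\<theta> * f \<sigma>)) + (1 - q) * cyl_exp ?B' z (\<lambda>\<sigma>. exp (\<theta> * f \<sigma>))"
      by (rule split[OF loce])
    also have "\<dots> \<le> q * exp (\<theta> * cyl_exp ?B' y f + ?R) + (1 - q) * exp (\<theta> * cyl_exp ?B' z f + ?R)"
      using q by (intro add_mono mult_left_mono step.IH) auto
    also have "\<dots> = (q * exp (\<theta> * cyl_exp ?B' y f) + (1 - q) * exp (\<theta> * cyl_exp ?B' z f)) * exp ?R"
      by (simp add: exp_add distrib_right)
    also have "\<dots> \<le> exp (\<theta> * (q * cyl_exp ?B' y f + (1 - q) * cyl_exp ?B' z f) + \<theta>\<^sup>2 * D\<^sup>2 / 8) * exp ?R"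
      by (intro mult_right_mono Hoeffding_two_point q osc) simp
    also have "q * cyl_exp ?B' y f + (1 - q) * cyl_exp ?B' z f = cyl_exp ?B x f"
      by (rule split[OF loc, symmetric])
    also have "exp (\<theta> * cyl_exp ?B x f + \<theta>\<^sup>2 * D\<^sup>2 / 8) * exp ?R =
        exp (\<theta> * cyl_exp ?B x f + (real (M - Suc k) + 1) * (\<theta>\<^sup>2 * D\<^sup>2 / 8))"
      unfolding exp_add[symmetric] by (simp only: distrib_right mult_1 add.assoc add.commute[of ?R])
    also have "real (M - Suc k) + 1 = real (M - k)" using step.hyps by (simp add: of_nat_diff)
    finally show ?case .
  qed
  from this[of 0 undefined]
  have "expectation (\<lambda>\<sigma>. exp (\<theta> * f \<sigma>)) \<le> exp (\<theta> * expectation f + real M * (\<theta>\<^sup>2 * D\<^sup>2 / 8))"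
    by (simp add: cyl_exp_empty)
  hence "expectation (\<lambda>\<sigma>. exp (\<theta> * f \<sigma>)) * exp (- (\<theta> * expectation f)) \<le>
      exp (\<theta> * expectation f + real M * (\<theta>\<^sup>2 * D\<^sup>2 / 8)) * exp (- (\<theta> * expectation f))"
    by (rule mult_right_mono) simp
  also have "\<dots> = exp (real M * (\<theta>\<^sup>2 * D\<^sup>2 / 8))" by (simp flip: exp_add)
  also have "expectation (\<lambda>\<sigma>. exp (\<theta> * f \<sigma>)) * exp (- (\<theta> * expectation f)) =
      expectation (\<lambda>\<sigma>. exp (\<theta> * f \<sigma>) * exp (- (\<theta> * expectation f)))"
    by simp
  finally show ?thesis by (simp add: D_def right_diff_distrib flip: exp_add)
qed

lemma gaussian_concentration:
  obtains L where "0 < L"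
    "\<And>M f c t. depends_on {1..int M} f \<Longrightarrow> coord_lipschitz c f \<Longrightarrow> 0 < c \<Longrightarrow> 0 < M \<Longrightarrow> 0 < t \<Longrightarrow>
       prob {\<sigma> \<in> space P. \<bar>f \<sigma> - expectation f\<bar> > t} \<le> 2 * exp (- (2 * t\<^sup>2 / (real M * (c * L)\<^sup>2)))"
proof -
  obtain C where C: "0 \<le> C" and mix: "\<And>n. mixing_bound n (C / (real n + 1)\<^sup>2)"
    using mixing_bound_inverse_square by blast
  define \<phi> where "\<phi> = (\<lambda>n. C / (real n + 1)\<^sup>2)"
  have "summable (\<lambda>n. 1 / (real n + 1)\<^sup>2)"
    using summable_Suc_iff[of "\<lambda>n. inverse ((real n)\<^sup>2)"] inverse_power_summable[of 2, where 'a = real]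
    by (simp add: inverse_eq_divide add.commute)
  hence \<phi>: "summable \<phi>" "\<And>n. 0 \<le> \<phi> n"
    using C summable_mult[of "\<lambda>n. 1 / (real n + 1)\<^sup>2" C] by (auto simp: \<phi>_def)
  have mix\<phi>: "\<And>n. mixing_bound n (\<phi> n)" using mix by (simp add: \<phi>_def)
  define L where "L = 1 + 2 * suminf \<phi>"
  have L: "0 < L" using suminf_nonneg[OF \<phi>] by (simp add: L_def)
  have upper: "prob {\<sigma> \<in> space P. f \<sigma> - expectation f \<ge> t} \<le> exp (- (2 * t\<^sup>2 / (real M * (c * L)\<^sup>2)))"
    if "depends_on {1..int M} f" "coord_lipschitz c f" "0 < c" "0 < M" "0 < t" for M f c t
  proof -
    define V where "V = real M * (c * L)\<^sup>2"
    have V: "0 < V" using that L by (simp add: V_def)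
    \<comment> \<open>The minimiser of the Chernoff exponent
      \<open>- \<theta> * t + \<theta>^2 * V / 8\<close>.\<close>
    define \<theta> where "\<theta> = 4 * t / V"
    have \<theta>: "0 < \<theta>" using V that by (simp add: \<theta>_def)
    have loc: "local_fun f" using that(1) by (auto intro: local_funI)
    have "integrable P (\<lambda>\<sigma>. exp (\<theta> * (f \<sigma> - expectation f)))"
      by (intro local_fun_integrable local_fun_comp[OF loc])
    hence "prob {\<sigma> \<in> space P. f \<sigma> - expectation f \<ge> t} \<le>
        exp (- \<theta> * t) * expectation (\<lambda>\<sigma>. exp (\<theta> * (f \<sigma> - expectation f)))"
      using Chernoff_ineq_ge[OF \<theta>, of "space P" "\<lambda>\<sigma>. f \<sigma> - expectation f" t] sets.top[of P]
      by (simp add: set_integrable_def set_lebesgue_integral_def)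
    also have "\<dots> \<le> exp (- \<theta> * t) * exp (real M * (\<theta>\<^sup>2 * (c * L)\<^sup>2 / 8))"
      unfolding L_def by (intro mult_left_mono exponential_moment[OF mix\<phi> \<phi> that(1,2)]) simp
    also have "\<dots> = exp (- \<theta> * t + \<theta>\<^sup>2 * V / 8)" by (simp add: V_def flip: exp_add)
    also have "- \<theta> * t + \<theta>\<^sup>2 * V / 8 = - (2 * t\<^sup>2 / V)"
      using V by (simp add: \<theta>_def field_simps power2_eq_square)
    finally show ?thesis by (simp add: V_def)
  qed
  show ?thesis
  proof (rule that[OF L])
    fix M f c and t :: real
    assume *: "depends_on {1..int M} f" "coord_lipschitz c f" "0 < c" "0 < M" "0 < t"
    have meas [measurable]: "f \<in> borel_measurable P"
      using *(1) by (intro local_fun_measurable) (auto intro: local_funI)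
    have events: "{\<sigma> \<in> space P. f \<sigma> - expectation f \<ge> t} \<in> events"
      "{\<sigma> \<in> space P. - f \<sigma> - expectation (\<lambda>\<sigma>. - f \<sigma>) \<ge> t} \<in> events"
      by measurable
    have "prob {\<sigma> \<in> space P. \<bar>f \<sigma> - expectation f\<bar> > t} \<le>
        prob ({\<sigma> \<in> space P. f \<sigma> - expectation f \<ge> t} \<union>
          {\<sigma> \<in> space P. - f \<sigma> - expectation (\<lambda>\<sigma>. - f \<sigma>) \<ge> t})"
      by (intro finite_measure_mono) (use events in auto)
    also have "\<dots> \<le> prob {\<sigma> \<in> space P. f \<sigma> - expectation f \<ge> t} +
        prob {\<sigma> \<in> space P. - f \<sigma> - expectation (\<lambda>\<sigma>. - f \<sigma>) \<ge> t}"
      by (intro measure_Un_le events)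
    also have "\<dots> \<le> exp (- (2 * t\<^sup>2 / (real M * (c * L)\<^sup>2))) + exp (- (2 * t\<^sup>2 / (real M * (c * L)\<^sup>2)))"
      by (intro add_mono upper[OF *]
          upper[OF depends_on_comp[OF *(1)] coord_lipschitz_uminus[OF *(2)] *(3-5)])
    finally show "prob {\<sigma> \<in> space P. \<bar>f \<sigma> - expectation f\<bar> > t} \<le>
        2 * exp (- (2 * t\<^sup>2 / (real M * (c * L)\<^sup>2)))" by simp
  qed
qed

end

subsection \<open>One-site conditional probabilities of cylinders\<close>

lemma vimage_cylinder_restrict:
  assumes "S \<subseteq> A"
  shows "(\<lambda>\<sigma>. restrict \<sigma> A) -` cylinder S \<eta> = cylinder S \<eta>"
  using assms by (auto simp: cylinder_def subset_iff)

lemma (in configuration_law) off_origin_measurable: "off_origin \<in> measurable P punctured_configs"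
  unfolding off_origin_def punctured_configs_def by (intro measurable_restrict) measurable

text \<open>A cylinder avoiding the origin belongs to the off-origin sigma-algebra, so the defining
  property of the conditional expectation can be integrated over it. Only integrals remain, and
  agreement almost everywhere is enough.\<close>

lemma (in configuration_law) cyl_prob_insert_origin:
  assumes version: "cond_prob_version P \<phi>" and S: "finite S" "0 \<notin> S"
    and bounds: "\<And>\<sigma>. \<sigma> \<in> cylinder S \<eta> \<Longrightarrow> a \<le> \<phi> (off_origin \<sigma>) (\<eta> 0)"
      "\<And>\<sigma>. \<sigma> \<in> cylinder S \<eta> \<Longrightarrow> \<phi> (off_origin \<sigma>) (\<eta> 0) \<le> b"
  shows "a * cyl_prob S \<eta> \<le> cyl_prob (insert 0 S) \<eta>" "cyl_prob (insert 0 S) \<eta> \<le> b * cyl_prob S \<eta>"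
proof -
  let ?F = "vimage_algebra (space P) off_origin punctured_configs"
  let ?I = "indicator {\<sigma> \<in> space P. \<sigma> 0 = \<eta> 0} :: (int \<Rightarrow> bool) \<Rightarrow> real"
  let ?g = "\<lambda>\<sigma>. indicator (cylinder S \<eta>) \<sigma> * \<phi> (off_origin \<sigma>) (\<eta> 0)"
  note [measurable] = off_origin_measurable
  interpret F: finite_measure_subalgebra P ?F
  proof
    show "subalgebra P ?F"
      unfolding subalgebra_def using sets_image_in_sets[OF refl off_origin_measurable] by simp
  qed
  have "cylinder S \<eta> = off_origin -` (cylinder S \<eta> \<inter> space punctured_configs) \<inter> space P"
    using S(2) vimage_cylinder_restrict[of S "- {0}" \<eta>]
    by (auto simp: off_origin_def punctured_configs_def space_PiM vimage_def)
  moreover have "cylinder S \<eta> \<inter> space punctured_configs \<in> sets punctured_configs"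
  proof -
    have "{\<tau> \<in> space punctured_configs. \<forall>i\<in>S. \<tau> i = \<eta> i} \<in> sets punctured_configs"
    proof (rule sets.sets_Collect_finite_All)
      fix i assume "i \<in> S"
      hence "i \<in> - {0}" using S(2) by auto
      hence "(\<lambda>\<tau>. \<tau> i) \<in> measurable punctured_configs (count_space UNIV)"
        unfolding punctured_configs_def by measurable
      thus "{\<tau> \<in> space punctured_configs. \<tau> i = \<eta> i} \<in> sets punctured_configs"
        by (cases "\<eta> i") simp_all
    qed (rule S(1))
    moreover have "{\<tau> \<in> space punctured_configs. \<forall>i\<in>S. \<tau> i = \<eta> i} = cylinder S \<eta> \<inter> space punctured_configs"
      by (auto simp: cylinder_def)
    ultimately show ?thesis by simp
  qed
  ultimately have A: "cylinder S \<eta> \<in> sets ?F" by (metis in_vimage_algebra)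
  have I: "integrable P ?I" by (intro integrable_const_bound[of _ 1]) auto
  have \<phi>: "(\<lambda>\<tau>. \<phi> \<tau> (\<eta> 0)) \<in> borel_measurable punctured_configs"
    "AE \<sigma> in P. \<phi> (off_origin \<sigma>) (\<eta> 0) = real_cond_exp P ?F ?I \<sigma>"
    using version by (auto simp: cond_prob_version_def)
  have meas: "(\<lambda>\<sigma>. \<phi> (off_origin \<sigma>) (\<eta> 0)) \<in> borel_measurable P"
    using measurable_compose[OF off_origin_measurable \<phi>(1)] .
  have cyl [measurable]: "cylinder S \<eta> \<in> sets P" using S(1) by simp
  have "cyl_prob (insert 0 S) \<eta> = (\<integral>\<sigma>\<in>cylinder S \<eta>. ?I \<sigma> \<partial>P)"
  proof -
    have "indicator (cylinder (insert 0 S) \<eta>) \<sigma> = indicator (cylinder S \<eta>) \<sigma> *\<^sub>R ?I \<sigma>" for \<sigma>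
      by (auto simp: indicator_def cylinder_def)
    hence "(\<integral>\<sigma>. indicator (cylinder (insert 0 S) \<eta>) \<sigma> \<partial>P) = (\<integral>\<sigma>\<in>cylinder S \<eta>. ?I \<sigma> \<partial>P)"
      unfolding set_lebesgue_integral_def by presburger
    thus ?thesis using S(1) by simp
  qed
  also have "\<dots> = (\<integral>\<sigma>\<in>cylinder S \<eta>. real_cond_exp P ?F ?I \<sigma> \<partial>P)"
    by (rule F.real_cond_exp_intA[OF I A])
  also have "\<dots> = (\<integral>\<sigma>. ?g \<sigma> \<partial>P)"
    unfolding set_lebesgue_integral_def real_scaleR_def
    using \<phi>(2) meas by (intro integral_cong_AE) auto
  finally have eq: "cyl_prob (insert 0 S) \<eta> = (\<integral>\<sigma>. ?g \<sigma> \<partial>P)" .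
  have "integrable P ?g"
  proof (rule integrable_const_bound[of _ "max \<bar>a\<bar> \<bar>b\<bar>"])
    have "\<bar>?g \<sigma>\<bar> \<le> max \<bar>a\<bar> \<bar>b\<bar>" for \<sigma>
      using bounds[of \<sigma>] by (cases "\<sigma> \<in> cylinder S \<eta>") auto
    thus "AE \<sigma> in P. norm (?g \<sigma>) \<le> max \<bar>a\<bar> \<bar>b\<bar>" by simp
  qed (use meas in measurable)
  note int = this
  have int': "integrable P (\<lambda>\<sigma>. u * indicator (cylinder S \<eta>) \<sigma>)" for u :: real
    by (intro integrable_mult_right) (auto intro!: integrable_const_bound[of _ 1])
  have le: "a * indicator (cylinder S \<eta>) \<sigma> \<le> ?g \<sigma>" "?g \<sigma> \<le> b * indicator (cylinder S \<eta>) \<sigma>" for \<sigma>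
    using bounds[of \<sigma>] by (auto simp: indicator_def)
  have "(\<integral>\<sigma>. a * indicator (cylinder S \<eta>) \<sigma> \<partial>P) \<le> (\<integral>\<sigma>. ?g \<sigma> \<partial>P)"
    "(\<integral>\<sigma>. ?g \<sigma> \<partial>P) \<le> (\<integral>\<sigma>. b * indicator (cylinder S \<eta>) \<sigma> \<partial>P)"
    by (rule integral_mono[OF int' int le(1)], rule integral_mono[OF int int' le(2)])
  thus "a * cyl_prob S \<eta> \<le> cyl_prob (insert 0 S) \<eta>" "cyl_prob (insert 0 S) \<eta> \<le> b * cyl_prob S \<eta>"
    using S(1) by (simp_all add: eq)
qed

lemma (in configuration_law) cyl_prob_translate:
  assumes "translation_invariant P" "finite S"
  shows "cyl_prob S \<eta> = cyl_prob ((\<lambda>j. j - k) ` S) (\<lambda>j. \<eta> (j + k))"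
proof -
  let ?T = "\<lambda>\<sigma> i. \<sigma> (i + k) :: bool"
  have T: "?T \<in> measurable P configs"
    unfolding configs_def by (intro measurable_PiM_single') auto
  have "cyl_prob ((\<lambda>j. j - k) ` S) (\<lambda>j. \<eta> (j + k)) =
      measure (distr P configs ?T) (cylinder ((\<lambda>j. j - k) ` S) (\<lambda>j. \<eta> (j + k)))"
    using assms(1) by (simp add: translation_invariant_def)
  also have "\<dots> = measure P (?T -` cylinder ((\<lambda>j. j - k) ` S) (\<lambda>j. \<eta> (j + k)) \<inter> space P)"
    using cylinder_sets[of "(\<lambda>j. j - k) ` S"] assms(2) T by (intro measure_distr) (auto simp: sets_P)
  also have "?T -` cylinder ((\<lambda>j. j - k) ` S) (\<lambda>j. \<eta> (j + k)) \<inter> space P = cylinder S \<eta>"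
    by (auto simp: cylinder_def)
  finally show ?thesis ..
qed

lemma exp_decaying_gibbs_quasi_local:
  assumes "exp_decaying_gibbs P"
  obtains \<delta> r where "quasi_local_law P \<delta> r"
proof -
  obtain \<phi> where P: "prob_space P" "sets P = sets configs" "translation_invariant P"
    and \<phi>: "cond_prob_version P \<phi>" "finite_energy \<phi>" "exp_decaying \<phi>"
    using assms by (auto simp: exp_decaying_gibbs_def)
  interpret configuration_law P
    using P by (auto simp: configuration_law_def configuration_law_axioms_def)
  obtain \<delta> where \<delta>: "0 < \<delta>"
    "\<And>\<eta> \<alpha>. \<eta> \<in> space punctured_configs \<Longrightarrow> \<delta> < \<phi> \<eta> \<alpha> \<and> \<phi> \<eta> \<alpha> < 1 - \<delta>"
    using \<phi>(2) unfolding finite_energy_def by blast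
  obtain \<rho> where \<rho>: "0 < \<rho>" "\<forall>n. \<forall>\<eta>\<in>space punctured_configs. \<forall>\<eta>'\<in>space punctured_configs.
       (\<forall>i\<in>{- int n..int n} \<inter> - {0}. \<eta> i = \<eta>' i) \<longrightarrow>
       (MAX \<alpha>. \<bar>\<phi> \<eta> \<alpha> - \<phi> \<eta>' \<alpha>\<bar>) \<le> exp (- (real n * \<rho>))"
    using \<phi>(3) unfolding exp_decaying_def by blast
  define r where "r = exp (- \<rho>)"
  have off: "off_origin \<sigma> \<in> space punctured_configs" for \<sigma>
    by (simp add: off_origin_def punctured_configs_def space_PiM)
  have energy0: "\<delta> * cyl_prob S \<eta> \<le> cyl_prob (insert 0 S) \<eta>" if "finite S" "0 \<notin> S" for S \<eta>
    using \<delta>(2)[OF off] that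
    by (intro cyl_prob_insert_origin(1)[OF \<phi>(1), where b = "1 - \<delta>"]) (auto intro: less_imp_le)
  \<comment> \<open>The decay estimate divides by cylinder probabilities, so positivity comes first;
    each added site is translated to the origin.\<close>
  have pos: "0 < cyl_prob S \<eta>" if "finite S" for S \<eta>
    using that
  proof (induction S rule: finite_induct)
    case empty
    then show ?case using prob_space by simp
  next
    case (insert i S)
    let ?S = "(\<lambda>j. j - i) ` S" and ?\<eta> = "\<lambda>j. \<eta> (j + i)"
    have "0 < \<delta> * cyl_prob S \<eta>" using \<delta> insert by simp
    also have "cyl_prob S \<eta> = cyl_prob ?S ?\<eta>" by (rule cyl_prob_translate[OF P(3) insert.hyps(1)])
    also have "\<delta> * \<dots> \<le> cyl_prob (insert 0 ?S) ?\<eta>" using insert.hyps by (intro energy0) auto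
    also have "\<dots> = cyl_prob (insert i S) \<eta>"
      using cyl_prob_translate[OF P(3), of "insert i S" \<eta> i] insert.hyps by simp
    finally show ?case .
  qed
  have near: "\<bar>\<phi> (off_origin \<sigma>) \<alpha> - \<phi> (off_origin \<tau>) \<alpha>\<bar> \<le> r ^ n"
    if "\<And>j. j \<in> {- int n..int n} - {0} \<Longrightarrow> \<sigma> j = \<tau> j" for \<sigma> \<tau> \<alpha> n
  proof -
    have "\<bar>\<phi> (off_origin \<sigma>) \<alpha> - \<phi> (off_origin \<tau>) \<alpha>\<bar> \<le>
        (MAX \<alpha>. \<bar>\<phi> (off_origin \<sigma>) \<alpha> - \<phi> (off_origin \<tau>) \<alpha>\<bar>)"
      by (intro Max_ge) auto
    also have "\<dots> \<le> exp (- (real n * \<rho>))"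
      using that by (intro \<rho>(2)[rule_format] off) (auto simp: off_origin_def)
    also have "\<dots> = r ^ n" by (simp add: r_def exp_of_nat_mult[symmetric])
    finally show ?thesis .
  qed
  \<comment> \<open>The quotient averages \<open>\<phi>\<close> over configurations that all agree
    with \<open>\<eta>\<close> on the punctured window.\<close>
  have approx0: "\<bar>cyl_prob (insert 0 S) \<xi> / cyl_prob S \<xi> - \<phi> (off_origin \<eta>) (\<eta> 0)\<bar> \<le> r ^ n"
    if S: "finite S" "0 \<notin> S" "{- int n..int n} - {0} \<subseteq> S"
      and agree: "\<And>j. j \<in> {- int n..int n} \<Longrightarrow> \<xi> j = \<eta> j" for S \<xi> \<eta> n
  proof -
    have b: "\<phi> (off_origin \<eta>) (\<eta> 0) - r ^ n \<le> \<phi> (off_origin \<sigma>) (\<xi> 0)"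
      "\<phi> (off_origin \<sigma>) (\<xi> 0) \<le> \<phi> (off_origin \<eta>) (\<eta> 0) + r ^ n" if "\<sigma> \<in> cylinder S \<xi>" for \<sigma>
    proof -
      have "\<sigma> j = \<eta> j" if "j \<in> {- int n..int n} - {0}" for j
      proof -
        have "\<sigma> j = \<xi> j" using \<open>\<sigma> \<in> cylinder S \<xi>\<close> S(3) that by (auto simp: cylinder_def)
        thus ?thesis using agree[of j] that by simp
      qed
      hence "\<bar>\<phi> (off_origin \<sigma>) (\<eta> 0) - \<phi> (off_origin \<eta>) (\<eta> 0)\<bar> \<le> r ^ n" by (rule near)
      moreover have "\<xi> 0 = \<eta> 0" using agree[of 0] by simp
      ultimately show "\<phi> (off_origin \<eta>) (\<eta> 0) - r ^ n \<le> \<phi> (off_origin \<sigma>) (\<xi> 0)"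
        "\<phi> (off_origin \<sigma>) (\<xi> 0) \<le> \<phi> (off_origin \<eta>) (\<eta> 0) + r ^ n" by auto
    qed
    have "(\<phi> (off_origin \<eta>) (\<eta> 0) - r ^ n) * cyl_prob S \<xi> \<le> cyl_prob (insert 0 S) \<xi>"
      "cyl_prob (insert 0 S) \<xi> \<le> (\<phi> (off_origin \<eta>) (\<eta> 0) + r ^ n) * cyl_prob S \<xi>"
      using cyl_prob_insert_origin[OF \<phi>(1) S(1,2), of \<xi>, OF b] by auto
    hence "\<phi> (off_origin \<eta>) (\<eta> 0) - r ^ n \<le> cyl_prob (insert 0 S) \<xi> / cyl_prob S \<xi>"
      "cyl_prob (insert 0 S) \<xi> / cyl_prob S \<xi> \<le> \<phi> (off_origin \<eta>) (\<eta> 0) + r ^ n"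
      using pos[OF S(1), of \<xi>] by (simp_all only: pos_le_divide_eq pos_divide_le_eq)
    thus ?thesis by linarith
  qed
  have "quasi_local_law P \<delta> r"
  proof
    show "0 < \<delta>" "0 < r" "r < 1" using \<delta>(1) \<rho>(1) by (auto simp: r_def)
    fix S :: "int set" and i \<eta> assume S: "finite S" "i \<notin> S"
    have "0 \<notin> (\<lambda>j. j - i) ` S" using S(2) by auto
    thus "\<delta> * cyl_prob S \<eta> \<le> cyl_prob (insert i S) \<eta>"
      using energy0[of "(\<lambda>j. j - i) ` S" "\<lambda>j. \<eta> (j + i)"] S
        cyl_prob_translate[OF P(3), of S \<eta> i] cyl_prob_translate[OF P(3), of "insert i S" \<eta> i] by simp
  next
    fix S S' :: "int set" and i n and \<eta> \<zeta> :: "int \<Rightarrow> bool"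
    assume S: "finite S" "finite S'" "i \<notin> S" "i \<notin> S'"
      and win: "{i - int n..i + int n} - {i} \<subseteq> S \<inter> S'"
      and agree: "\<And>j. j \<in> {i - int n..i + int n} \<Longrightarrow> \<eta> j = \<zeta> j"
    \<comment> \<open>Both quotients are compared with this common value, each up to
      \<open>r ^ n\<close>.\<close>
    let ?v = "\<phi> (off_origin (\<lambda>j. \<zeta> (j + i))) (\<zeta> (0 + i))"
    have *: "\<bar>cyl_prob (insert i T) \<xi> / cyl_prob T \<xi> - ?v\<bar> \<le> r ^ n"
      if T: "finite T" "i \<notin> T" "{i - int n..i + int n} - {i} \<subseteq> T"
        and ag: "\<And>j. j \<in> {i - int n..i + int n} \<Longrightarrow> \<xi> j = \<zeta> j" for T \<xi>
    proof -
      have "cyl_prob T \<xi> = cyl_prob ((\<lambda>j. j - i) ` T) (\<lambda>j. \<xi> (j + i))"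
        "cyl_prob (insert i T) \<xi> = cyl_prob (insert 0 ((\<lambda>j. j - i) ` T)) (\<lambda>j. \<xi> (j + i))"
        using cyl_prob_translate[OF P(3), of T \<xi> i] cyl_prob_translate[OF P(3), of "insert i T" \<xi> i] T
        by simp_all
      moreover have "{- int n..int n} - {0} \<subseteq> (\<lambda>j. j - i) ` T"
      proof
        fix j assume "j \<in> {- int n..int n} - {0}"
        hence "j + i \<in> T" by (intro subsetD[OF T(3)]) auto
        thus "j \<in> (\<lambda>j. j - i) ` T" by (rule rev_image_eqI) simp
      qed
      ultimately show ?thesis
        using T ag by (simp only:, intro approx0) auto
    qed
    have "\<bar>cyl_prob (insert i S) \<eta> / cyl_prob S \<eta> - ?v\<bar> \<le> r ^ n"
      using S win agree by (intro *) auto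
    moreover have "\<bar>cyl_prob (insert i S') \<zeta> / cyl_prob S' \<zeta> - ?v\<bar> \<le> r ^ n"
      using S win by (intro *) auto
    ultimately show "\<bar>cyl_prob (insert i S) \<eta> / cyl_prob S \<eta> - cyl_prob (insert i S') \<zeta> / cyl_prob S' \<zeta>\<bar> \<le> 2 * r ^ n"
      by linarith
  qed
  thus ?thesis by (rule that)
qed

subsection \<open>Arithmetic progressions\<close>

lemma cesaro_mean_tendsto:
  fixes a :: "nat \<Rightarrow> real"
  assumes "a \<longlonglongrightarrow> L"
  shows "(\<lambda>N. 1 / real N * (\<Sum>i = 1..N. a i)) \<longlonglongrightarrow> L"
proof (rule LIMSEQ_I)
  fix e :: real assume e: "0 < e"
  obtain N0 where N0: "\<And>n. n \<ge> N0 \<Longrightarrow> \<bar>a n - L\<bar> < e / 2"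
    using LIMSEQ_D[OF assms, of "e / 2"] e by auto
  define K where "K = (\<Sum>i = 1..N0. \<bar>a i - L\<bar>)"
  have "norm (1 / real N * (\<Sum>i = 1..N. a i) - L) < e" if N: "N \<ge> Suc (nat \<lceil>2 * K / e\<rceil>)" for N
  proof -
    have pos: "0 < real N" and big: "2 * K / e < real N" using N by linarith+
    have "\<bar>(\<Sum>i = 1..N. a i) - real N * L\<bar> = \<bar>\<Sum>i = 1..N. a i - L\<bar>"
      by (simp add: sum_subtractf)
    also have "\<dots> \<le> (\<Sum>i = 1..N. \<bar>a i - L\<bar>)" by (rule sum_abs)
    also have "\<dots> \<le> (\<Sum>i = 1..N. (if i \<in> {1..N0} then \<bar>a i - L\<bar> else 0) + e / 2)"
      using N0 e by (intro sum_mono) (auto simp: not_le intro: less_imp_le)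
    also have "\<dots> = (\<Sum>i\<in>{1..N} \<inter> {1..N0}. \<bar>a i - L\<bar>) + real N * (e / 2)"
      by (subst sum.inter_restrict) (simp_all add: sum.distrib)
    also have "(\<Sum>i\<in>{1..N} \<inter> {1..N0}. \<bar>a i - L\<bar>) \<le> K"
      unfolding K_def by (intro sum_mono2) auto
    also have "K + real N * (e / 2) < real N * e"
      using big e by (simp add: field_simps)
    finally have "\<bar>(\<Sum>i = 1..N. a i) - real N * L\<bar> / real N < e"
      using pos by (simp add: pos_divide_less_eq mult.commute)
    also have "\<bar>(\<Sum>i = 1..N. a i) - real N * L\<bar> / real N = \<bar>1 / real N * (\<Sum>i = 1..N. a i) - L\<bar>"
    proof -
      have "((\<Sum>i = 1..N. a i) - real N * L) / real N = 1 / real N * (\<Sum>i = 1..N. a i) - L"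
        using pos by (simp add: diff_divide_distrib)
      thus ?thesis using pos by (metis abs_divide abs_of_pos)
    qed
    finally show ?thesis by simp
  qed
  thus "\<exists>no. \<forall>n\<ge>no. norm (1 / real n * (\<Sum>i = 1..n. a i) - L) < e" by blast
qed

text \<open>Borel-Cantelli at the countably many thresholds \<open>1 / real (Suc k)\<close> leaves a
  single null set.\<close>

lemma (in prob_space) AE_tendsto_of_summable_deviation:
  fixes X :: "nat \<Rightarrow> 'a \<Rightarrow> real" and m :: "nat \<Rightarrow> real"
  assumes [measurable]: "\<And>n. X n \<in> borel_measurable M" and m: "m \<longlonglongrightarrow> L"
    and sum: "\<And>t. t > 0 \<Longrightarrow> summable (\<lambda>n. prob {x \<in> space M. \<bar>X n x - m n\<bar> > t})"
  shows "AE x in M. (\<lambda>n. X n x) \<longlonglongrightarrow> L"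
proof -
  have "AE x in M. eventually (\<lambda>n. x \<in> space M - {x \<in> space M. \<bar>X n x - m n\<bar> > 1 / real (Suc k)}) sequentially" for k
    by (rule borel_cantelli_AE1) (auto intro!: sum simp: emeasure_eq_measure)
  hence "AE x in M. \<forall>k. eventually (\<lambda>n. x \<in> space M - {x \<in> space M. \<bar>X n x - m n\<bar> > 1 / real (Suc k)}) sequentially"
    by (subst AE_all_countable) blast
  thus ?thesis
  proof (rule AE_mp, intro AE_I2 impI)
    fix x assume x: "x \<in> space M" and
      ev: "\<forall>k. eventually (\<lambda>n. x \<in> space M - {x \<in> space M. \<bar>X n x - m n\<bar> > 1 / real (Suc k)}) sequentially"
    have "(\<lambda>n. X n x - m n) \<longlonglongrightarrow> 0"
    proof (rule tendstoI)
      fix e :: real assume "0 < e"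
      then obtain k where k: "1 / real (Suc k) < e" using nat_approx_posE by blast
      show "eventually (\<lambda>n. dist (X n x - m n) 0 < e) sequentially"
        using ev[rule_format, of k] by eventually_elim (use x k in \<open>auto simp: not_less\<close>)
    qed
    from tendsto_add[OF this m] show "(\<lambda>n. X n x) \<longlonglongrightarrow> L" by simp
  qed
qed

section \<open>Progressions as sets of sites\<close>

definition progression :: "nat \<Rightarrow> nat \<Rightarrow> int set" where
  "progression l i = (\<lambda>j. int j * int i) ` {1..l}"

lemma finite_progression [simp]: "finite (progression l i)"
  by (simp add: progression_def)

lemma card_progression: "i \<ge> 1 \<Longrightarrow> card (progression l i) = l"
  unfolding progression_def by (subst card_image) (auto simp: inj_on_def)

lemma progression_Suc: "progression (Suc l) i = insert (int (Suc l) * int i) (progression l i)"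
  by (simp add: progression_def atLeastAtMostSuc_conv)

lemma progression_le: "progression l i \<subseteq> {..int l * int i}"
  by (auto simp: progression_def mult_right_mono)

lemma prod_of_bool_progression:
  "(\<Prod>j = 1..l. of_bool (\<sigma> (int j * int i))) = (indicator (cylinder (progression l i) (\<lambda>_. True)) \<sigma> :: real)"
proof (cases "\<sigma> \<in> cylinder (progression l i) (\<lambda>_. True)")
  case True
  thus ?thesis by (auto simp: cylinder_def progression_def)
next
  case False
  thus ?thesis by (auto simp: cylinder_def progression_def intro!: prod_zero)
qed

lemma nonconv_avg_depends_on: "depends_on {1..int (l * N)} (nonconv_avg N l)"
proof (unfold depends_on_def, intro allI impI)
  fix \<sigma> \<tau> :: "int \<Rightarrow> bool" assume eq: "\<forall>i\<in>{1..int (l * N)}. \<sigma> i = \<tau> i"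
  have "\<sigma> (int j * int i) = \<tau> (int j * int i)" if "i \<in> {1..N}" "j \<in> {1..l}" for i j
  proof -
    have "1 * 1 \<le> j * i" "j * i \<le> l * N" using that by (intro mult_le_mono; simp)+
    hence "int j * int i \<in> {1..int (l * N)}"
      unfolding of_nat_mult[symmetric] atLeastAtMost_iff by linarith
    thus ?thesis using eq by blast
  qed
  thus "nonconv_avg N l \<sigma> = nonconv_avg N l \<tau>"
    unfolding nonconv_avg_def by (intro arg_cong2[where f = "(*)"] sum.cong prod.cong refl) simp
qed

text \<open>A site \<open>k\<close> lies on the progression with step \<open>i\<close> only if
  \<open>i = k div j\<close> for some \<open>j\<close> in \<open>1..l\<close>. Changing it thus
  alters at most \<open>l\<close> summands, each by at most 1.\<close>

lemma nonconv_avg_coord_lipschitz: "coord_lipschitz (real l / real N) (nonconv_avg N l)"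
  unfolding coord_lipschitz_def
proof (intro allI)
  fix \<sigma> :: "int \<Rightarrow> bool" and k b
  let ?I = "\<lambda>i. indicator (cylinder (progression l i) (\<lambda>_. True)) :: _ \<Rightarrow> real"
  let ?hit = "{i \<in> {1..N}. k \<in> progression l i}"
  have "?hit \<subseteq> (\<lambda>j. nat (k div int j)) ` {1..l}"
  proof
    fix i assume i: "i \<in> ?hit"
    then obtain j where j: "j \<in> {1..l}" "k = int j * int i" by (auto simp: progression_def)
    hence "i = nat (k div int j)" by simp
    thus "i \<in> (\<lambda>j. nat (k div int j)) ` {1..l}" using j(1) by (rule image_eqI)
  qed
  hence "card ?hit \<le> card ((\<lambda>j. nat (k div int j)) ` {1..l})" by (intro card_mono) auto
  also have "\<dots> \<le> l" using card_image_le[of "{1..l}"] by simp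
  finally have card: "card ?hit \<le> l" .
  have "\<bar>?I i (\<sigma>(k := b)) - ?I i \<sigma>\<bar> \<le> (if i \<in> ?hit then 1 else 0)" if "i \<in> {1..N}" for i
  proof (cases "k \<in> progression l i")
    case True
    thus ?thesis using that by (auto simp: indicator_def)
  next
    case False
    hence "?I i (\<sigma>(k := b)) = ?I i \<sigma>"
      by (intro depends_onD[OF depends_on_cylinder]) auto
    thus ?thesis by simp
  qed
  hence "\<bar>\<Sum>i = 1..N. ?I i (\<sigma>(k := b)) - ?I i \<sigma>\<bar> \<le> (\<Sum>i = 1..N. if i \<in> ?hit then 1 else 0)"
    by (intro order_trans[OF sum_abs] sum_mono)
  also have "\<dots> = real (card ?hit)"
    by (simp add: sum.If_cases Int_def)
  finally have "\<bar>\<Sum>i = 1..N. ?I i (\<sigma>(k := b)) - ?I i \<sigma>\<bar> \<le> real l" using card by simp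
  hence "1 / real N * \<bar>\<Sum>i = 1..N. ?I i (\<sigma>(k := b)) - ?I i \<sigma>\<bar> \<le> 1 / real N * real l"
    by (intro mult_left_mono) auto
  thus "\<bar>nonconv_avg N l (\<sigma>(k := b)) - nonconv_avg N l \<sigma>\<bar> \<le> real l / real N"
    unfolding nonconv_avg_def prod_of_bool_progression
    by (simp add: sum_subtractf abs_mult flip: right_diff_distrib diff_divide_distrib)
qed

lemma (in configuration_law) expectation_sum_progressions:
  "expectation (\<lambda>\<sigma>. \<Sum>i\<in>I. \<Prod>j = 1..l. of_bool (\<sigma> (int j * int i))) =
    (\<Sum>i\<in>I. cyl_prob (progression l i) (\<lambda>_. True))"
  unfolding prod_of_bool_progression
  by (subst Bochner_Integration.integral_sum)
    (auto intro!: local_fun_integrable local_funI[OF _ depends_on_cylinder])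

context quasi_local_law
begin

text \<open>Consecutive sites are \<open>i\<close> apart, so appending one multiplies the
  probability by \<open>p\<close> up to a mixing error that vanishes as \<open>i\<close>
  grows.\<close>

lemma progression_prob_tendsto:
  assumes p: "\<And>i. cyl_prob {i} (\<lambda>_. True) = p"
  shows "(\<lambda>i. cyl_prob (progression l i) (\<lambda>_. True)) \<longlonglongrightarrow> p ^ l"
proof (induction l)
  case 0
  thus ?case using prob_space by (simp add: progression_def)
next
  case (Suc l)
  let ?\<eta> = "\<lambda>_ :: int. True" and ?Q = "\<lambda>l i. cyl_prob (progression l i) (\<lambda>_. True)"
  obtain C where C: "0 \<le> C" and mix: "\<And>n. mixing_bound n (C / (real n + 1)\<^sup>2)"
    using mixing_bound_inverse_square by blast
  have step: "\<bar>?Q (Suc l) i - ?Q l i * p\<bar> \<le> C / (real i)\<^sup>2" if i: "i \<ge> 1" for i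
  proof -
    let ?B = "progression l i" and ?k = "int (Suc l) * int i"
    let ?h = "indicator (cylinder {?k} ?\<eta>) :: _ \<Rightarrow> real"
    \<comment> \<open>The new site is the centre of this interval, at depth \<open>i - 1\<close>,
      and no earlier site lies in it. The empty second boundary makes the comparison one with
      \<open>p\<close>.\<close>
    have "?B \<inter> {int l * int i + 1..int (l + 2) * int i - 1} = {}"
      using progression_le[of l i] by auto
    moreover have "?k = int l * int i + 1 + int (i - 1)" "?k = int (l + 2) * int i - 1 - int (i - 1)"
      using i by (simp_all add: algebra_simps)
    hence "depends_on {int l * int i + 1 + int (i - 1)..int (l + 2) * int i - 1 - int (i - 1)} ?h"
      by (intro depends_on_mono[OF depends_on_cylinder]) simp
    ultimately have "cyl_exp ?B ?\<eta> ?h - cyl_exp {} ?\<eta> ?h \<le> C / (real (i - 1) + 1)\<^sup>2"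
      "cyl_exp {} ?\<eta> ?h - cyl_exp ?B ?\<eta> ?h \<le> C / (real (i - 1) + 1)\<^sup>2"
      by (intro mixing_boundD[OF mix]; simp)+
    hence mix': "\<bar>cyl_exp ?B ?\<eta> ?h - p\<bar> \<le> C / (real i)\<^sup>2"
      using p[of ?k] i by (simp add: cyl_exp_empty of_nat_diff abs_le_iff)
    have "cyl_exp ?B ?\<eta> ?h = ?Q (Suc l) i / ?Q l i"
    proof -
      have "indicator (cylinder ?B ?\<eta>) \<sigma> * ?h \<sigma> = indicator (cylinder (progression (Suc l) i) ?\<eta>) \<sigma>" for \<sigma>
        by (auto simp: indicator_def cylinder_def progression_Suc)
      thus ?thesis by (simp add: cyl_exp_def)
    qed
    moreover have pos: "0 < ?Q l i" by (intro cyl_prob_pos) simp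
    ultimately have "?Q (Suc l) i - ?Q l i * p = ?Q l i * (cyl_exp ?B ?\<eta> ?h - p)"
      by (simp add: right_diff_distrib)
    hence "\<bar>?Q (Suc l) i - ?Q l i * p\<bar> = ?Q l i * \<bar>cyl_exp ?B ?\<eta> ?h - p\<bar>"
      using pos by (simp only: abs_mult abs_of_pos)
    also have "\<dots> \<le> 1 * \<bar>cyl_exp ?B ?\<eta> ?h - p\<bar>"
      by (intro mult_right_mono) auto
    finally show ?thesis using mix' by simp
  qed
  have "(\<lambda>i. C * (inverse (real i))\<^sup>2) \<longlonglongrightarrow> C * 0\<^sup>2"
    by (intro tendsto_intros lim_inverse_n)
  hence "(\<lambda>i. C / (real i)\<^sup>2) \<longlonglongrightarrow> 0"
    by (simp add: power_inverse divide_inverse)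
  hence "(\<lambda>i. ?Q (Suc l) i - ?Q l i * p) \<longlonglongrightarrow> 0"
    by (rule Lim_null_comparison[rotated])
      (use step in \<open>auto intro!: eventually_sequentiallyI[of 1]\<close>)
  from tendsto_add[OF this tendsto_mult_right[OF Suc.IH, of p]]
  show ?case by (simp add: mult.commute)
qed

lemma delta_less_one: "\<delta> < 1"
  using cyl_prob_flip[of "{}" 0 "\<lambda>_. True"] energy[of "{}" 0 "\<lambda>_. True"] delta_pos
    energy[of "{}" 0 "(\<lambda>_. True)(0 := False)"] prob_space by simp

text \<open>By \<open>energy\<close>, the opposite symbol always takes a share of at least
  \<open>\<delta>\<close>, leaving at most \<open>1 - \<delta>\<close> for the prescribed
  one.\<close>

lemma cyl_prob_le_power:
  assumes "finite S"
  shows "cyl_prob S \<eta> \<le> (1 - \<delta>) ^ card S"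
  using assms
proof (induction S rule: finite_induct)
  case (insert i S)
  have "cylinder S (\<eta>(i := \<not> \<eta> i)) = cylinder S \<eta>"
    using insert.hyps by (intro cylinder_cong) auto
  hence "cyl_prob (insert i S) \<eta> \<le> (1 - \<delta>) * cyl_prob S \<eta>"
    using cyl_prob_flip[OF insert.hyps, of \<eta>] energy[OF insert.hyps, of "\<eta>(i := \<not> \<eta> i)"]
    by (simp add: algebra_simps)
  also have "\<dots> \<le> (1 - \<delta>) * (1 - \<delta>) ^ card S"
    using delta_less_one insert.IH by (intro mult_left_mono) auto
  finally show ?case using insert.hyps by simp
qed simp

end

section \<open>Conclusions for averages and for long progressions\<close>

lemma (in quasi_local_law) nonconv_avg_concentration:
  assumes l: "l \<ge> 1"
  obtains C where "C > 0"
    "\<And>N t. N \<ge> 1 \<Longrightarrow> t > 0 \<Longrightarrow>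
       prob {\<sigma> \<in> space P. \<bar>nonconv_avg N l \<sigma> - expectation (nonconv_avg N l)\<bar> > t}
         \<le> 2 * exp (- (C * real N * t\<^sup>2))"
proof -
  obtain L where L: "0 < L" and conc:
    "\<And>M f c t. depends_on {1..int M} f \<Longrightarrow> coord_lipschitz c f \<Longrightarrow> 0 < c \<Longrightarrow> 0 < M \<Longrightarrow> 0 < t \<Longrightarrow>
       prob {\<sigma> \<in> space P. \<bar>f \<sigma> - expectation f\<bar> > t} \<le> 2 * exp (- (2 * t\<^sup>2 / (real M * (c * L)\<^sup>2)))"
    using gaussian_concentration by blast
  show ?thesis
  \<comment> \<open>With \<open>M = l * N\<close> sites and Lipschitz constant
    \<open>c = l / N\<close>, the variance proxy \<open>M * c^2\<close> equals
    \<open>l^3 / N\<close>.\<close>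
  proof (rule that[of "2 / (real l ^ 3 * L\<^sup>2)"])
    show "2 / (real l ^ 3 * L\<^sup>2) > 0" using l L by simp
    fix N :: nat and t :: real assume N: "N \<ge> 1" and t: "t > 0"
    have "prob {\<sigma> \<in> space P. \<bar>nonconv_avg N l \<sigma> - expectation (nonconv_avg N l)\<bar> > t} \<le>
        2 * exp (- (2 * t\<^sup>2 / (real (l * N) * (real l / real N * L)\<^sup>2)))"
      using l N t by (intro conc nonconv_avg_depends_on nonconv_avg_coord_lipschitz) auto
    also have "2 * t\<^sup>2 / (real (l * N) * (real l / real N * L)\<^sup>2) = 2 / (real l ^ 3 * L\<^sup>2) * real N * t\<^sup>2"
      using l N L by (simp add: field_simps power2_eq_square power3_eq_cube)
    finally show "prob {\<sigma> \<in> space P. \<bar>nonconv_avg N l \<sigma> - expectation (nonconv_avg N l)\<bar> > t}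
         \<le> 2 * exp (- (2 / (real l ^ 3 * L\<^sup>2) * real N * t\<^sup>2))" .
  qed
qed

lemma (in configuration_law) expectation_nonconv_avg:
  "expectation (nonconv_avg N l) = 1 / real N * (\<Sum>i = 1..N. cyl_prob (progression l i) (\<lambda>_. True))"
  unfolding nonconv_avg_def integral_mult_right_zero expectation_sum_progressions ..

lemma (in configuration_law) expectation_coordinate:
  assumes "translation_invariant P"
  shows "cyl_prob {i} (\<lambda>_. True) = expectation (\<lambda>\<sigma>. of_bool (\<sigma> 0))"
proof -
  have "of_bool (\<sigma> 0) = indicat_real (cylinder {0} (\<lambda>_. True)) \<sigma>" for \<sigma>
    by (simp add: indicator_def cylinder_def)
  hence "expectation (\<lambda>\<sigma>. of_bool (\<sigma> 0)) = cyl_prob {0} (\<lambda>_. True)" by simp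
  thus ?thesis using cyl_prob_translate[OF assms, of "{i}" "\<lambda>_. True" i] by simp
qed

lemma (in quasi_local_law) nonconv_avg_AE_tendsto:
  assumes inv: "translation_invariant P" and l: "l \<ge> 1"
  shows "AE \<sigma> in P. (\<lambda>N. nonconv_avg N l \<sigma>) \<longlonglongrightarrow> expectation (\<lambda>\<sigma>. of_bool (\<sigma> 0)) ^ l"
proof (rule AE_tendsto_of_summable_deviation)
  show "nonconv_avg N l \<in> borel_measurable P" for N
    by (intro local_fun_measurable local_funI[OF _ nonconv_avg_depends_on]) simp
  show "(\<lambda>N. expectation (nonconv_avg N l)) \<longlonglongrightarrow> expectation (\<lambda>\<sigma>. of_bool (\<sigma> 0)) ^ l"
    unfolding expectation_nonconv_avg
    by (intro cesaro_mean_tendsto progression_prob_tendsto expectation_coordinate inv)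
  fix t :: real assume t: "t > 0"
  obtain C where C: "C > 0" "\<And>N t. N \<ge> 1 \<Longrightarrow> t > 0 \<Longrightarrow>
       prob {\<sigma> \<in> space P. \<bar>nonconv_avg N l \<sigma> - expectation (nonconv_avg N l)\<bar> > t}
         \<le> 2 * exp (- (C * real N * t\<^sup>2))"
    using nonconv_avg_concentration[OF l] by blast
  have "summable (\<lambda>N. 2 * exp (- (C * t\<^sup>2)) ^ N)"
    using C t by (intro summable_mult summable_geometric) simp
  thus "summable (\<lambda>N. prob {\<sigma> \<in> space P. \<bar>nonconv_avg N l \<sigma> - expectation (nonconv_avg N l)\<bar> > t})"
  proof (rule summable_comparison_test'[where N = 1])
    fix N :: nat assume "N \<ge> 1"
    thus "norm (prob {\<sigma> \<in> space P. \<bar>nonconv_avg N l \<sigma> - expectation (nonconv_avg N l)\<bar> > t}) \<le>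
        2 * exp (- (C * t\<^sup>2)) ^ N"
      using C(2)[of N t] t by (simp add: exp_of_nat_mult[symmetric] mult_ac)
  qed
qed

text \<open>Each progression consists of \<open>l\<close> distinct sites. For \<open>l = 0\<close>
  the count is empty because \<open>N div 0 = 0\<close>, so the values of \<open>N\<close> where the
  logarithmic length rounds to 0 are covered too.\<close>

lemma (in quasi_local_law) expectation_num_progressions_le:
  "expectation (num_progressions N l) \<le> real N * (1 - \<delta>) ^ l"
proof -
  have "expectation (num_progressions N l) = (\<Sum>i = 1..N div l. cyl_prob (progression l i) (\<lambda>_. True))"
    unfolding num_progressions_def by (rule expectation_sum_progressions)
  also have "\<dots> \<le> (\<Sum>i = 1..N div l. (1 - \<delta>) ^ l)"
  proof (rule sum_mono)
    fix i assume "i \<in> {1..N div l}"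
    thus "cyl_prob (progression l i) (\<lambda>_. True) \<le> (1 - \<delta>) ^ l"
      using cyl_prob_le_power[OF finite_progression, of l i "\<lambda>_. True"] by (simp add: card_progression)
  qed
  also have "\<dots> = real (N div l) * (1 - \<delta>) ^ l" by simp
  also have "\<dots> \<le> real N * (1 - \<delta>) ^ l"
    using delta_less_one by (intro mult_right_mono) auto
  finally show ?thesis .
qed

text \<open>First moment method: with \<open>a = - ln (1 - \<delta>)\<close>, the expected count is
  at most a constant times \<open>N powr (1 - a * c)\<close>, and this exponent is negative exactly
  when \<open>c > 1 / a\<close>.\<close>

lemma (in quasi_local_law) num_progressions_tendsto_zero:
  assumes c: "c > 1 / - ln (1 - \<delta>)"
  shows "tendsto_zero_in_prob P (\<lambda>N. num_progressions N (nat \<lfloor>c * ln (real N)\<rfloor>))"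
  unfolding tendsto_zero_in_prob_def
proof (intro allI impI)
  fix \<epsilon> :: real assume \<epsilon>: "\<epsilon> > 0"
  define a where "a = - ln (1 - \<delta>)"
  have a: "a > 0" "1 - \<delta> = exp (- a)" using delta_pos delta_less_one by (auto simp: a_def)
  have ac: "1 - a * c < 0" and c0: "c > 0"
    using c a(1) by (auto simp: a_def[symmetric] field_simps intro: less_trans[OF _ c])
  have bound: "prob {\<sigma> \<in> space P. \<bar>num_progressions N (nat \<lfloor>c * ln (real N)\<rfloor>) \<sigma>\<bar> > \<epsilon>} \<le>
      exp a / \<epsilon> * real N powr (1 - a * c)" if N: "N \<ge> 1" for N
  proof -
    define l where "l = nat \<lfloor>c * ln (real N)\<rfloor>"
    \<comment> \<open>Rounding down loses at most 1, which accounts for the factor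
      \<open>exp a\<close> in the bound.\<close>
    have l: "c * ln (real N) - 1 \<le> real l" unfolding l_def using c0 N by linarith
    have loc: "local_fun (num_progressions N l)"
      unfolding num_progressions_def prod_of_bool_progression
      by (intro local_fun_sum local_funI[OF _ depends_on_cylinder]) simp
    have nonneg: "0 \<le> num_progressions N l \<sigma>" for \<sigma>
      unfolding num_progressions_def by (intro sum_nonneg prod_nonneg) auto
    note [measurable] = local_fun_measurable[OF loc]
    have "{\<sigma> \<in> space P. num_progressions N l \<sigma> \<ge> \<epsilon>} \<in> events" by measurable
    hence "prob {\<sigma> \<in> space P. \<bar>num_progressions N l \<sigma>\<bar> > \<epsilon>} \<le> prob {\<sigma> \<in> space P. num_progressions N l \<sigma> \<ge> \<epsilon>}"
      using nonneg by (intro finite_measure_mono) auto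
    also have "\<dots> \<le> expectation (num_progressions N l) / \<epsilon>"
      using local_fun_integrable[OF loc] nonneg \<epsilon>
      by (intro integral_Markov_inequality_measure[where A = "{}"]) auto
    also have "\<dots> \<le> real N * (1 - \<delta>) ^ l / \<epsilon>"
      using \<epsilon> by (intro divide_right_mono expectation_num_progressions_le) auto
    also have "\<dots> \<le> real N * exp (- (a * (c * ln (real N) - 1))) / \<epsilon>"
    proof -
      have "(1 - \<delta>) ^ l = exp (- (a * real l))"
        unfolding a(2) by (simp add: exp_of_nat_mult[symmetric] mult.commute)
      also have "\<dots> \<le> exp (- (a * (c * ln (real N) - 1)))" using l a by simp
      finally show ?thesis using \<epsilon> by (intro divide_right_mono mult_left_mono) auto
    qed
    also have "real N * exp (- (a * (c * ln (real N) - 1))) / \<epsilon> = exp a / \<epsilon> * real N powr (1 - a * c)"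
    proof -
      have "real N * exp (- (a * (c * ln (real N) - 1))) = exp (ln (real N)) * exp (- (a * (c * ln (real N) - 1)))"
        using N by simp
      also have "\<dots> = exp a * exp ((1 - a * c) * ln (real N))"
        unfolding exp_add[symmetric] by (simp add: algebra_simps)
      also have "exp ((1 - a * c) * ln (real N)) = real N powr (1 - a * c)"
        using N by (simp add: powr_def)
      finally show ?thesis by simp
    qed
    finally show ?thesis by (simp add: l_def)
  qed
  have "(\<lambda>N. exp a / \<epsilon> * real N powr (1 - a * c)) \<longlonglongrightarrow> exp a / \<epsilon> * 0"
    by (intro tendsto_mult_left tendsto_neg_powr[OF ac] filterlim_real_sequentially)
  hence lim: "(\<lambda>N. exp a / \<epsilon> * real N powr (1 - a * c)) \<longlonglongrightarrow> 0" by simp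
  show "(\<lambda>N. prob {\<sigma> \<in> space P. \<bar>num_progressions N (nat \<lfloor>c * ln (real N)\<rfloor>) \<sigma>\<bar> > \<epsilon>}) \<longlonglongrightarrow> 0"
  proof (rule Lim_null_comparison[OF _ lim])
    show "\<forall>\<^sub>F N in sequentially. norm (prob {\<sigma> \<in> space P. \<bar>num_progressions N (nat \<lfloor>c * ln (real N)\<rfloor>) \<sigma>\<bar> > \<epsilon>}) \<le>
        exp a / \<epsilon> * real N powr (1 - a * c)"
      using eventually_ge_at_top[of 1] by eventually_elim (use bound in simp)
  qed
qed

text \<open>The factor 2 is the union of the two tails and cannot be dropped for all
  \<open>t > 0\<close>. For \<open>N = l = 1\<close> and \<open>p\<close> the probability that site
  1 carries \<open>True\<close>, the deviation is always at least \<open>min p (1 - p)\<close>,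
  which is positive. For smaller \<open>t\<close> the left side is therefore 1, whereas
  \<open>exp (- (C * t^2)) < 1\<close> for every \<open>C > 0\<close>.\<close>

theorem proposition3p1:
  fixes P :: "(int \<Rightarrow> bool) measure"
  assumes "exp_decaying_gibbs P"
  shows "(\<forall>l::nat. l \<ge> 1 \<longrightarrow>
            (\<exists>C>0. \<forall>N::nat. \<forall>t::real. N \<ge> 1 \<longrightarrow> t > 0 \<longrightarrow>
               measure P {\<sigma> \<in> space P.
                   \<bar>nonconv_avg N l \<sigma> - (\<integral>\<omega>. nonconv_avg N l \<omega> \<partial>P)\<bar> > t}
                 \<le> 2 * exp (- (C * real N * t\<^sup>2))) \<and>
            (AE \<sigma> in P. (\<lambda>N. nonconv_avg N l \<sigma>)
               \<longlonglongrightarrow> (\<integral>\<omega>. of_bool (\<omega> 0) \<partial>P) ^ l)) \<and>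
         (\<exists>\<gamma>::real. \<gamma> > 0 \<and> (\<forall>c>\<gamma>.
            tendsto_zero_in_prob P
              (\<lambda>N. num_progressions N (nat \<lfloor>c * ln (real N)\<rfloor>))))"
proof -
  obtain \<delta> r where "quasi_local_law P \<delta> r"
    using exp_decaying_gibbs_quasi_local[OF assms] by blast
  then interpret quasi_local_law P \<delta> r .
  have inv: "translation_invariant P" using assms by (simp add: exp_decaying_gibbs_def)
  show ?thesis
  proof (intro conjI allI impI)
    fix l :: nat assume l: "l \<ge> 1"
    obtain C where "C > 0" "\<And>N t. N \<ge> 1 \<Longrightarrow> t > 0 \<Longrightarrow>
        prob {\<sigma> \<in> space P. \<bar>nonconv_avg N l \<sigma> - expectation (nonconv_avg N l)\<bar> > t}
          \<le> 2 * exp (- (C * real N * t\<^sup>2))"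
      using nonconv_avg_concentration[OF l] by blast
    thus "\<exists>C>0. \<forall>N t. N \<ge> 1 \<longrightarrow> t > 0 \<longrightarrow>
        prob {\<sigma> \<in> space P. \<bar>nonconv_avg N l \<sigma> - expectation (nonconv_avg N l)\<bar> > t}
          \<le> 2 * exp (- (C * real N * t\<^sup>2))"
      by (intro exI[of _ C]) simp
    show "AE \<sigma> in P. (\<lambda>N. nonconv_avg N l \<sigma>) \<longlonglongrightarrow> expectation (\<lambda>\<omega>. of_bool (\<omega> 0)) ^ l"
      by (rule nonconv_avg_AE_tendsto[OF inv l])
  next
    have "0 < 1 / - ln (1 - \<delta>)" using delta_pos delta_less_one by simp
    thus "\<exists>\<gamma>>0. \<forall>c>\<gamma>. tendsto_zero_in_prob P (\<lambda>N. num_progressions N (nat \<lfloor>c * ln (real N)\<rfloor>))"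
      using num_progressions_tendsto_zero by (intro exI[of _ "1 / - ln (1 - \<delta>)"]) simp
  qed
qed

end
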